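(* Let $N\geqslant 4$. For a positive integer $s$ let $\widehat{\alpha}(s)$ denote the Waldschmidt constant of the defining ideal of $s$ generic points in $\mathbb{P}^N$. Then for all positive integers $b$ and $k$, $$\widehat{\alpha}\big(b\cdot (2^N)^k\big)\geqslant 2^k\,\widehat{\alpha}(b).$$
   Context: $\Bbbk$ is an algebraically closed field. Generic points: let $\mathbf{z}=(z_{ij})_{1\leqslant i\leqslant s,\,0\leqslant j\leqslant N}$ be $s(N+1)$ independent indeterminates over $\Bbbk$ and $\Bbbk(\mathbf{z})$ the rational function field; the set of $s$ generic points is $\{P_1(\mathbf{z}),\dots,P_s(\mathbf{z})\}\subset\mathbb{P}^N_{\Bbbk(\mathbf{z})}$ with $P_i(\mathbf{z})=[z_{i0}:\dots:z_{iN}]$, and its defining ideal lies in $\Bbbk(\mathbf{z})[x_0,\dots,x_N]$. If $I=\mathfrak{p}_1\cap\dots\cap\mathfrak{p}_s$ is the defining ideal of points $P_1,\dots,P_s$ ($\mathfrak{p}_i$ the homogeneous ideal of $P_i$), its symbolic powers are $I^{(m)}=\mathfrak{p}_1^m\cap\dots\cap\mathfrak{p}_s^m$. For a nonzero homogeneous ideal $J$, $\alpha(J)$ is the least degree of a nonzero element of $J$. The Waldschmidt constant is $\widehat{\alpha}(I)=\lim_{m\to\infty}\alpha(I^{(m)})/m=\inf_{m\geqslant 1}\alpha(I^{(m)})/m$. *)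

theory Defs
  imports
    Complex_Main
    "HOL-Library.Poly_Mapping"
    "HOL-Computational_Algebra.Polynomial"
    "HOL-Computational_Algebra.Fraction_Field"
    "HOL-Algebra.Ideal_Product"
begin

text \<open>
  Multivariate polynomials are finitely supported maps from monomials to coefficients, and
  monomials are finitely supported maps from variable indices to exponents. The type provides
  countably many variables; the number of variables actually in use is fixed by explicit
  carrier sets below.
\<close>

type_synonym mon = "nat \<Rightarrow>\<^sub>0 nat"
type_synonym 'a mpol = "mon \<Rightarrow>\<^sub>0 'a"

definition mon_degree :: "mon \<Rightarrow> nat" where
  "mon_degree m = (\<Sum>j \<in> Poly_Mapping.keys m. Poly_Mapping.lookup m j)"

text \<open>Only meaningful for \<open>f \<noteq> 0\<close>.\<close>

definition total_degree :: "'a::zero mpol \<Rightarrow> nat" where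
  "total_degree f = Max (mon_degree ` Poly_Mapping.keys f)"

definition homogeneous :: "nat \<Rightarrow> 'a::zero mpol \<Rightarrow> bool" where
  "homogeneous d f \<longleftrightarrow> (\<forall>m \<in> Poly_Mapping.keys f. mon_degree m = d)"

definition eval_at :: "(nat \<Rightarrow> 'a::comm_semiring_1) \<Rightarrow> 'a mpol \<Rightarrow> 'a" where
  "eval_at p f = (\<Sum>m \<in> Poly_Mapping.keys f. Poly_Mapping.lookup f m *
     (\<Prod>j \<in> Poly_Mapping.keys m. p j ^ Poly_Mapping.lookup m j))"

text \<open>\<open>F[x\<^sub>0, \<dots>, x\<^sub>N]\<close> for a subfield \<open>F\<close> of the ambient field.\<close>

definition coord_ring :: "'a::field set \<Rightarrow> nat \<Rightarrow> 'a mpol ring" where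
  "coord_ring F N =
     \<lparr> carrier = {f. \<forall>m \<in> Poly_Mapping.keys f.
                       Poly_Mapping.lookup f m \<in> F \<and> Poly_Mapping.keys m \<subseteq> {..N}},
       mult = (*), one = 1, zero = 0, add = (+) \<rparr>"

text \<open>
  A point of projective \<open>N\<close>-space over \<open>F\<close> is given by its homogeneous coordinates \<open>p 0, \<dots>, p N\<close> in \<open>F\<close>.
\<close>

definition point_ideal :: "'a::field set \<Rightarrow> nat \<Rightarrow> (nat \<Rightarrow> 'a) \<Rightarrow> 'a mpol set" where
  "point_ideal F N p = genideal (coord_ring F N)
     {f \<in> carrier (coord_ring F N). (\<exists>d. homogeneous d f) \<and> eval_at p f = 0}"

text \<open>The \<open>m\<close>-th symbolic power of the defining ideal of the points \<open>P 0, \<dots>, P (s - 1)\<close>.\<close>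

definition symbolic_power ::
    "'a::field set \<Rightarrow> nat \<Rightarrow> nat \<Rightarrow> (nat \<Rightarrow> nat \<Rightarrow> 'a) \<Rightarrow> nat \<Rightarrow> 'a mpol set" where
  "symbolic_power F N s P m =
     (\<Inter>i<s. point_ideal F N (P i) [^]\<^bsub>ideals_set (coord_ring F N)\<^esub> m)"

definition alpha :: "'a::zero mpol set \<Rightarrow> nat" where
  "alpha J = (LEAST d. \<exists>f \<in> J. f \<noteq> 0 \<and> total_degree f = d)"

definition waldschmidt :: "'a::field set \<Rightarrow> nat \<Rightarrow> nat \<Rightarrow> (nat \<Rightarrow> nat \<Rightarrow> 'a) \<Rightarrow> real" where
  "waldschmidt F N s P = lim (\<lambda>m. real (alpha (symbolic_power F N s P m)) / real m)"

text \<open>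
  The \<open>s (N + 1)\<close> indeterminates \<open>z\<^sub>i\<^sub>j\<close> with \<open>i < s\<close> and \<open>j \<le> N\<close> are the variables with
  index \<open>i (N + 1) + j\<close>, that is, exactly those with index below \<open>s (N + 1)\<close>. Accordingly the
  field \<open>k(z)\<close> is the subfield of the fractions of polynomials in these variables only.
\<close>

type_synonym 'k ratfun = "'k mpol fract"

definition generic_field :: "nat \<Rightarrow> nat \<Rightarrow> 'k::field ratfun set" where
  "generic_field N s =
     {Fract p q | p q. q \<noteq> 0 \<and>
        (\<forall>m \<in> Poly_Mapping.keys p \<union> Poly_Mapping.keys q.
           Poly_Mapping.keys m \<subseteq> {..<s * (N + 1)})}"

definition generic_point :: "nat \<Rightarrow> nat \<Rightarrow> nat \<Rightarrow> 'k::field ratfun" where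
  "generic_point N i j =
     Fract (Poly_Mapping.single (Poly_Mapping.single (i * (N + 1) + j) 1) 1) 1"

definition generic_waldschmidt :: "'k::field itself \<Rightarrow> nat \<Rightarrow> nat \<Rightarrow> real" where
  "generic_waldschmidt _ N s =
     waldschmidt (generic_field N s :: 'k ratfun set) N s (generic_point N)"

end

theory Submission
  imports Defs
begin

text \<open>
  Replace \<open>2 ^ k\<close> by any \<open>s > 0\<close>: a nonzero form vanishing to order \<open>m\<close> at \<open>b s\<^sup>N\<close> generic points
  yields one of no larger degree vanishing to order \<open>s m\<close> at \<open>b\<close> generic points, and dividing by \<open>m\<close>
  gives \<open>\<alpha>(b s\<^sup>N) \<ge> s \<alpha>(b)\<close> in the limit.

  To obtain it, let the points collide in \<open>b\<close> clusters: the points of the \<open>i\<close>-th cluster become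
  \<open>z\<^sub>i + t q + t\<^sup>2 w\<close>, where \<open>q\<close> runs through a grid \<open>S\<^sup>N\<close> of constants with \<open>card S = s\<close>; the constants \<open>w\<close>,
  together with a rescaling of the coordinate vectors, are chosen such that the form does not
  specialize to zero. Let \<open>F\<close> be the coefficient of the lowest power of \<open>t\<close>. In coordinates \<open>t u\<close> around
  \<open>z\<^sub>i\<close> the lowest power \<open>t\<^sup>e\<close> has a nonzero coefficient \<open>g(u)\<close> of degree at most \<open>e\<close> that vanishes to order
  \<open>m\<close> on the grid, so \<open>e \<ge> s m\<close>, while \<open>F\<close> vanishes to order at least \<open>e\<close> at \<open>z\<^sub>i\<close>.
\<close>

abbreviation keys :: "('a \<Rightarrow>\<^sub>0 'b::zero) \<Rightarrow> 'a set" where "keys \<equiv> Poly_Mapping.keys"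
abbreviation lookup :: "('a \<Rightarrow>\<^sub>0 'b::zero) \<Rightarrow> 'a \<Rightarrow> 'b" where "lookup \<equiv> Poly_Mapping.lookup"

section \<open>Ring homomorphisms\<close>

locale rhom =
  fixes h :: "'a::comm_ring_1 \<Rightarrow> 'b::comm_ring_1"
  assumes add: "h (x + y) = h x + h y"
    and mult: "h (x * y) = h x * h y"
    and one: "h 1 = 1"
begin

lemma zero: "h 0 = 0"
  using add[of 0 0] by simp

lemma diff: "h (x - y) = h x - h y"
  using add[of "x - y" y] by simp

lemma sum: "h (sum f A) = (\<Sum>x\<in>A. h (f x))"
  by (induction A rule: infinite_finite_induct) (simp_all add: zero add)

lemma prod: "h (prod f A) = (\<Prod>x\<in>A. h (f x))"
  by (induction A rule: infinite_finite_induct) (simp_all add: one mult)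

lemma power: "h (x ^ n) = h x ^ n"
  by (induction n) (simp_all add: one mult)

end

lemma rhom_comp: "rhom g \<Longrightarrow> rhom h \<Longrightarrow> rhom (\<lambda>x. g (h x))"
  by (simp add: rhom_def)

lemma rhom_id: "rhom (\<lambda>x. x)"
  by (simp add: rhom_def)

section \<open>Evaluation of multivariate polynomials\<close>

definition C :: "'a::zero \<Rightarrow> 'a mpol" where
  "C a = Poly_Mapping.single 0 a"

definition X :: "nat \<Rightarrow> 'a::zero_neq_one mpol" where
  "X j = Poly_Mapping.single (Poly_Mapping.single j 1) 1"

definition mon_ev :: "(nat \<Rightarrow> 'b::comm_ring_1) \<Rightarrow> mon \<Rightarrow> 'b" where
  "mon_ev \<sigma> m = (\<Prod>j\<in>keys m. \<sigma> j ^ lookup m j)"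

text \<open>Taking \<open>h = C\<close> gives substitution, \<open>h\<close> the identity gives
  evaluation at a point, and \<open>\<sigma> = X\<close> with \<open>C\<close> after the coefficient
  map gives change of coefficients. One set of rules serves all three.\<close>

definition ev :: "('a::zero \<Rightarrow> 'b::comm_ring_1) \<Rightarrow> (nat \<Rightarrow> 'b) \<Rightarrow> 'a mpol \<Rightarrow> 'b" where
  "ev h \<sigma> f = (\<Sum>m\<in>keys f. h (lookup f m) * mon_ev \<sigma> m)"

lemma mon_ev_superset:
  "finite A \<Longrightarrow> keys m \<subseteq> A \<Longrightarrow> mon_ev \<sigma> m = (\<Prod>j\<in>A. \<sigma> j ^ lookup m j)"
  unfolding mon_ev_def by (rule prod.mono_neutral_left) (auto simp: in_keys_iff)

lemma ev_superset:
  assumes "finite A" "keys f \<subseteq> A" "h 0 = 0"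
  shows "ev h \<sigma> f = (\<Sum>m\<in>A. h (lookup f m) * mon_ev \<sigma> m)"
  unfolding ev_def by (rule sum.mono_neutral_left) (use assms in \<open>auto simp: in_keys_iff\<close>)

lemma mon_ev_zero [simp]: "mon_ev \<sigma> 0 = 1"
  by (simp add: mon_ev_def)

lemma mon_ev_single [simp]: "mon_ev \<sigma> (Poly_Mapping.single j n) = \<sigma> j ^ n"
  by (simp add: mon_ev_def)

lemma mon_ev_add: "mon_ev \<sigma> (m + n) = mon_ev \<sigma> m * mon_ev \<sigma> n"
proof -
  let ?A = "keys m \<union> keys n"
  have "mon_ev \<sigma> (m + n) = (\<Prod>j\<in>?A. \<sigma> j ^ lookup (m + n) j)"
    by (rule mon_ev_superset) (simp_all add: keys_add)
  also have "\<dots> = (\<Prod>j\<in>?A. \<sigma> j ^ lookup m j) * (\<Prod>j\<in>?A. \<sigma> j ^ lookup n j)"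
    by (simp add: lookup_add power_add prod.distrib)
  also have "\<dots> = mon_ev \<sigma> m * mon_ev \<sigma> n"
    by (simp add: mon_ev_superset[of ?A])
  finally show ?thesis .
qed

lemma C_0 [simp]: "C 0 = 0" and C_1 [simp]: "C 1 = 1"
  by (simp_all add: C_def)

lemma C_eq_0_iff [simp]: "C a = 0 \<longleftrightarrow> a = 0"
  by (metis C_0 C_def lookup_single_eq lookup_zero)

lemma rhom_C: "rhom C"
  by standard (simp_all add: C_def single_add mult_single)

lemma inj_C: "inj (C :: 'a::zero \<Rightarrow> 'a mpol)"
  by (rule injI) (metis C_def lookup_single_eq)

lemma X_nonzero [simp]: "X j \<noteq> 0"
  by (metis X_def lookup_single_eq lookup_zero zero_neq_one)

lemma ev_single: "h 0 = 0 \<Longrightarrow> ev h \<sigma> (Poly_Mapping.single m a) = h a * mon_ev \<sigma> m"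
  by (cases "a = 0") (simp_all add: ev_def)

lemma ev_C: "h 0 = 0 \<Longrightarrow> ev h \<sigma> (C a) = h a"
  by (simp add: C_def ev_single)

lemma ev_X: "h 0 = 0 \<Longrightarrow> h 1 = 1 \<Longrightarrow> ev h \<sigma> (X j) = \<sigma> j"
  by (simp add: X_def ev_single)

lemma ev_cong:
  assumes "\<And>m j. m \<in> keys f \<Longrightarrow> j \<in> keys m \<Longrightarrow> \<sigma> j = \<tau> j"
  shows "ev h \<sigma> f = ev h \<tau> f"
  unfolding ev_def mon_ev_def using assms by (auto intro!: sum.cong arg_cong2[of _ _ _ _ "(*)"] prod.cong)

lemma sum_singles: "f = (\<Sum>m\<in>keys f. Poly_Mapping.single m (lookup f m))"
  for f :: "'a \<Rightarrow>\<^sub>0 'b::comm_monoid_add"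
  by (rule poly_mapping_eqI)
    (auto simp: lookup_sum lookup_single when_def in_keys_iff sum.delta)

lemma ev_add:
  assumes "rhom h" shows "ev h \<sigma> (f + g) = ev h \<sigma> f + ev h \<sigma> g"
proof -
  interpret rhom h by fact
  let ?A = "keys f \<union> keys g"
  have "ev h \<sigma> (f + g) = (\<Sum>m\<in>?A. h (lookup (f + g) m) * mon_ev \<sigma> m)"
    by (rule ev_superset) (simp_all add: keys_add zero)
  also have "\<dots> = ev h \<sigma> f + ev h \<sigma> g"
    by (simp add: ev_superset[of ?A] zero lookup_add add distrib_right sum.distrib)
  finally show ?thesis .
qed

lemma ev_sum: "rhom h \<Longrightarrow> ev h \<sigma> (sum f A) = (\<Sum>x\<in>A. ev h \<sigma> (f x))"
  by (induction A rule: infinite_finite_induct) (simp_all add: ev_add, simp_all add: ev_def)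

lemma ev_mult:
  assumes "rhom h" shows "ev h \<sigma> (f * g) = ev h \<sigma> f * ev h \<sigma> g"
proof -
  interpret rhom h by fact
  have "f * g = (\<Sum>m\<in>keys f. \<Sum>n\<in>keys g. Poly_Mapping.single (m + n) (lookup f m * lookup g n))"
    by (subst sum_singles[of f], subst sum_singles[of g]) (simp add: sum_product mult_single)
  then have "ev h \<sigma> (f * g) =
      (\<Sum>m\<in>keys f. \<Sum>n\<in>keys g. h (lookup f m * lookup g n) * mon_ev \<sigma> (m + n))"
    by (simp add: ev_sum[OF assms] ev_single zero)
  also have "\<dots> = ev h \<sigma> f * ev h \<sigma> g"
    unfolding ev_def by (simp add: sum_product mult mon_ev_add mult_ac)
  finally show ?thesis .
qed

lemma rhom_ev: "rhom h \<Longrightarrow> rhom (ev h \<sigma>)"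
  by (rule rhom.intro) (simp_all add: ev_add ev_mult, simp add: ev_def rhom.one)

lemma rhom_mon_ev: "rhom g \<Longrightarrow> g (mon_ev \<sigma> m) = mon_ev (\<lambda>j. g (\<sigma> j)) m"
  by (simp add: mon_ev_def rhom.prod rhom.power)

lemma rhom_ev_comp: "rhom g \<Longrightarrow> g (ev h \<sigma> f) = ev (\<lambda>a. g (h a)) (\<lambda>j. g (\<sigma> j)) f"
  by (simp add: ev_def rhom.sum rhom.mult rhom_mon_ev)

lemma ev_ev:
  assumes "rhom h" "rhom h'"
  shows "ev h \<sigma> (ev (\<lambda>a. C (h' a)) \<tau> f) = ev (\<lambda>a. h (h' a)) (\<lambda>j. ev h \<sigma> (\<tau> j)) f"
  using rhom_ev_comp[OF rhom_ev[OF assms(1)], of \<sigma> "\<lambda>a. C (h' a)" \<tau> f]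
  by (simp add: ev_C rhom.zero assms)

lemma mon_ev_scale: "mon_ev (\<lambda>j. C (a j) * X j) m = Poly_Mapping.single m (mon_ev a m)"
proof -
  have X_power: "X j ^ n = (Poly_Mapping.single (Poly_Mapping.single j n) 1 :: 'a mpol)" for j n
    by (induction n) (simp_all add: X_def mult_single single_add[symmetric])
  have "(\<Prod>j\<in>A. (C (a j) * X j) ^ e j) =
      Poly_Mapping.single (\<Sum>j\<in>A. Poly_Mapping.single j (e j)) (\<Prod>j\<in>A. a j ^ e j)" if "finite A" for A e
    using that
    by induction
      (simp_all add: power_mult_distrib X_power C_def mult_single flip: rhom.power[OF rhom_C, unfolded C_def])
  then show ?thesis
    unfolding mon_ev_def by (simp flip: sum_singles)
qed

text \<open>A substitution x_j -> a_j x_j acts diagonally on monomials. With a_j in {0, 1} it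
  deletes variables, with a_j = t on \<open>J\<close> it multiplies by t to the weight, and with all
  a_j = 1 only the coefficients change.\<close>

lemma lookup_ev_scale:
  assumes "h 0 = 0"
  shows "lookup (ev (\<lambda>c. C (h c)) (\<lambda>j. C (a j) * X j) f) m = h (lookup f m) * mon_ev a m"
  unfolding ev_def mon_ev_scale
  by (auto simp: C_def mult_single lookup_sum lookup_single when_def assms sum.delta in_keys_iff)

section \<open>Change of coefficients\<close>

definition mapc :: "('a \<Rightarrow> 'b::comm_ring_1) \<Rightarrow> 'a::zero mpol \<Rightarrow> 'b mpol" where
  "mapc h = ev (\<lambda>c. C (h c)) X"

lemma lookup_mapc: "h 0 = 0 \<Longrightarrow> lookup (mapc h f) m = h (lookup f m)"
  using lookup_ev_scale[of h "\<lambda>_. 1" f m] by (simp add: mapc_def mon_ev_def)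

lemma keys_mapc: "h 0 = 0 \<Longrightarrow> keys (mapc h f) \<subseteq> keys f"
  by (auto simp: in_keys_iff lookup_mapc)

lemma rhom_mapc: "rhom h \<Longrightarrow> rhom (mapc h)"
  unfolding mapc_def by (intro rhom_ev rhom_comp[OF rhom_C])

lemma mapc_C: "h 0 = 0 \<Longrightarrow> mapc h (C a) = C (h a)"
  unfolding mapc_def by (subst ev_C) simp_all

lemma mapc_X: "rhom h \<Longrightarrow> mapc h (X j) = X j"
  unfolding mapc_def by (subst ev_X) (simp_all add: rhom.zero rhom.one)

text \<open>Rewriting \<open>f\<close> as \<open>ev C X f\<close> reduces an identity between
  composed substitutions to a check on the variables.\<close>

lemma ev_C_X [simp]: "ev C X f = f"
  by (rule poly_mapping_eqI) (use lookup_mapc[of "\<lambda>x. x" f] in \<open>simp add: mapc_def\<close>)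

lemma ev_mapc:
  assumes "h 0 = 0" "g 0 = 0"
  shows "ev g \<sigma> (mapc h f) = ev (\<lambda>a. g (h a)) \<sigma> f"
  by (simp add: ev_superset[of "keys f"] keys_mapc lookup_mapc assms)

section \<open>Order of vanishing at a projective point\<close>

definition wt :: "nat set \<Rightarrow> mon \<Rightarrow> nat" where
  "wt J m = (\<Sum>j\<in>J. lookup m j)"

lemma wt_add: "wt J (m + n) = wt J m + wt J n"
  by (simp add: wt_def lookup_add sum.distrib)

text \<open>For finite \<open>J\<close> this is membership in the \<open>k\<close>-th power of the
  ideal generated by the variables with index in \<open>J\<close>.\<close>

definition low :: "nat set \<Rightarrow> nat \<Rightarrow> 'a::zero mpol \<Rightarrow> bool" where
  "low J k f \<longleftrightarrow> (\<forall>m\<in>keys f. k \<le> wt J m)"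

lemma low_zero [simp]: "low J k 0"
  by (simp add: low_def)

lemma low_0 [simp]: "low J 0 f"
  by (simp add: low_def)

lemma low_add: "low J k f \<Longrightarrow> low J k g \<Longrightarrow> low J k (f + g)"
  using keys_add[of f g] by (auto simp: low_def)

lemma low_mult:
  fixes f g :: "'a::comm_ring_1 mpol"
  shows "low J k f \<Longrightarrow> low J l g \<Longrightarrow> low J (k + l) (f * g)"
  using keys_mult[of f g] by (fastforce simp: low_def wt_add add_mono)

text \<open>
  With \<open>J = {1..N}\<close> and \<open>p 0 \<noteq> 0\<close>, the substitution \<open>shift\<close> turns the linear forms vanishing at \<open>p\<close> into the
  combinations of \<open>x\<^sub>1, \<dots>, x\<^sub>N\<close>, so \<open>vanish J k p\<close> describes the \<open>k\<close>-th power of the ideal of \<open>p\<close>.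
\<close>

definition shift :: "nat set \<Rightarrow> (nat \<Rightarrow> 'a::comm_ring_1) \<Rightarrow> 'a mpol \<Rightarrow> 'a mpol" where
  "shift J p = ev C (\<lambda>j. if j = 0 then C (p 0) * X 0
                         else if j \<in> J then C (p j) * X 0 + X j else X j)"

definition vanish :: "nat set \<Rightarrow> nat \<Rightarrow> (nat \<Rightarrow> 'a::comm_ring_1) \<Rightarrow> 'a mpol \<Rightarrow> bool" where
  "vanish J k p f \<longleftrightarrow> low J k (shift J p f)"

lemma rhom_shift: "rhom (shift J p)"
  unfolding shift_def by (intro rhom_ev rhom_C)

lemma shift_X: "shift J p (X j) = (if j = 0 then C (p 0) * X 0
    else if j \<in> J then C (p j) * X 0 + X j else X j)"
  unfolding shift_def by (subst ev_X) simp_all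

lemma shift_C: "shift J p (C a) = C a"
  unfolding shift_def by (subst ev_C) simp_all

lemma shift_ev: "shift J p (ev C \<tau> f) = ev C (\<lambda>j. shift J p (\<tau> j)) f"
  unfolding shift_def by (rule ev_ev[OF rhom_C rhom_id])

lemma mapc_shift:
  assumes "rhom h"
  shows "mapc h (shift J p f) = shift J (\<lambda>j. h (p j)) (mapc h f)"
proof -
  interpret rhom h by fact
  interpret M: rhom "mapc h" by (rule rhom_mapc) fact
  have "shift J (\<lambda>j. h (p j)) (mapc h f) = ev (\<lambda>a. C (h a))
      (\<lambda>j. if j = 0 then C (h (p 0)) * X 0 else if j \<in> J then C (h (p j)) * X 0 + X j else X j) f"
    unfolding shift_def by (rule ev_mapc) (simp_all add: zero)
  also have "\<dots> = mapc h (shift J p f)"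
    unfolding shift_def rhom_ev_comp[OF M.rhom_axioms]
    by (rule arg_cong2[of _ _ _ _ "\<lambda>a b. ev a b f"])
      (auto simp: fun_eq_iff mapc_C[of h, OF zero] mapc_X[OF assms] M.add M.mult)
  finally show ?thesis ..
qed

lemma vanish_mapc:
  assumes "rhom h" "vanish J k p f"
  shows "vanish J k (\<lambda>j. h (p j)) (mapc h f)"
  using assms(2) keys_mapc[of h "shift J p f", OF rhom.zero[OF assms(1)]]
  unfolding vanish_def mapc_shift[OF assms(1), symmetric] low_def by blast

text \<open>An injective change of coefficients kills no monomial. This brings orders of vanishing
  back from a fraction field to the polynomial ring inside it.\<close>

lemma vanish_mapc_inj:
  assumes "rhom h" "inj h" "vanish J k (\<lambda>j. h (p j)) (mapc h f)"
  shows "vanish J k p f"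
proof -
  have "keys (mapc h g) = keys g" for g
    using inj_eq[OF assms(2), of _ 0] rhom.zero[OF assms(1)]
    by (simp add: set_eq_iff in_keys_iff lookup_mapc)
  then show ?thesis
    using assms(3) unfolding vanish_def mapc_shift[OF assms(1), symmetric] low_def by metis
qed

subsection \<open>The grading by weight\<close>

lemma mon_ev_mult: "mon_ev (\<lambda>j. \<sigma> j * \<tau> j) m = mon_ev \<sigma> m * mon_ev \<tau> m"
  by (simp add: mon_ev_def power_mult_distrib prod.distrib)

lemma mon_ev_X: "mon_ev X m = (Poly_Mapping.single m 1 :: 'a::comm_ring_1 mpol)"
  using mon_ev_scale[of "\<lambda>_. 1" m] by (simp add: mon_ev_def)

lemma mon_ev_wt:
  assumes "finite J"
  shows "mon_ev (\<lambda>j. if j \<in> J then t else 1) m = t ^ wt J m"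
proof -
  have "mon_ev (\<lambda>j. if j \<in> J then t else 1) m =
      (\<Prod>j\<in>keys m \<union> J. (if j \<in> J then t else 1) ^ lookup m j)"
    by (rule mon_ev_superset) (use assms in auto)
  also have "\<dots> = (\<Prod>j\<in>J. t ^ lookup m j)"
    by (rule prod.mono_neutral_cong_right) (use assms in auto)
  also have "\<dots> = t ^ wt J m"
    by (simp add: wt_def power_sum)
  finally show ?thesis .
qed

text \<open>The variables in \<open>J\<close> are multiplied by a new variable, whose n-th
  coefficient then collects the part of weight n. Lowest and highest weight become the order at 0
  and the degree of a univariate polynomial.\<close>

definition grad :: "nat set \<Rightarrow> 'a::comm_ring_1 mpol \<Rightarrow> 'a mpol poly" where
  "grad J = ev (\<lambda>a. [:C a:]) (\<lambda>j. [:X j:] * (if j \<in> J then [:0, 1:] else 1))"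

lemma rhom_const_poly: "rhom (\<lambda>a. [:a:])"
  by standard (simp_all add: one_pCons)

lemma rhom_grad: "rhom (grad J)"
  unfolding grad_def by (intro rhom_ev rhom_comp[OF rhom_const_poly rhom_C])

lemma grad_X: "grad J (X j) = [:X j:] * (if j \<in> J then [:0, 1:] else 1)"
  unfolding grad_def by (subst ev_X) (simp_all add: one_pCons)

lemma grad_C: "grad J (C a) = [:C a:]"
  unfolding grad_def by (subst ev_C) simp_all

lemma lookup_coeff_grad:
  assumes "finite J"
  shows "lookup (poly.coeff (grad J f) n) m = (lookup f m when wt J m = n)"
proof -
  have T_power: "[:0, 1:] ^ n = (monom 1 n :: 'a mpol poly)" for n
    by (induction n) (simp_all add: monom_Suc monom_0 one_pCons)
  have "grad J f = (\<Sum>m\<in>keys f. monom (Poly_Mapping.single m (lookup f m)) (wt J m))"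
    unfolding grad_def ev_def mon_ev_mult mon_ev_wt[OF assms]
      rhom_mon_ev[OF rhom_const_poly, symmetric] mon_ev_X
    by (intro sum.cong refl)
      (simp add: C_def mult_single T_power smult_monom)
  then have "lookup (poly.coeff (grad J f) n) m =
      (\<Sum>m'\<in>keys f. if m' = m then (lookup f m when wt J m = n) else 0)"
    by (simp only: coeff_sum lookup_sum, intro sum.cong refl) (auto simp: when_def lookup_single)
  also have "\<dots> = (lookup f m when wt J m = n)"
    by (auto simp: sum.delta in_keys_iff)
  finally show ?thesis .
qed

lemma grad_eq_0_iff: "finite J \<Longrightarrow> grad J f = 0 \<longleftrightarrow> f = 0"
proof
  assume J: "finite J" and "grad J f = 0"
  then have "lookup f m = 0" for m
    using lookup_coeff_grad[OF J, of f "wt J m" m] by simp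
  then show "f = 0" by (intro poly_mapping_eqI) simp
qed (simp add: rhom.zero[OF rhom_grad])

text \<open>Over a domain the univariate order is additive on products, which is what dividing by
  linear forms requires.\<close>

lemma low_iff_order:
  fixes f :: "'a::idom mpol"
  assumes "finite J"
  shows "low J k f \<longleftrightarrow> f = 0 \<or> k \<le> Polynomial.order 0 (grad J f)"
proof -
  have "low J k f \<longleftrightarrow> (\<forall>n<k. poly.coeff (grad J f) n = 0)"
    unfolding low_def poly_mapping_eq_iff fun_eq_iff lookup_coeff_grad[OF assms] in_keys_iff
      lookup_zero when_def
    by (simp add: Ball_def in_keys_iff) (metis linorder_not_le)
  also have "\<dots> \<longleftrightarrow> monom 1 k dvd grad J f"
    by (simp add: monom_1_dvd_iff')
  also have "\<dots> \<longleftrightarrow> f = 0 \<or> k \<le> Polynomial.order 0 (grad J f)"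
    using monom_1_dvd_iff[of "grad J f" k] grad_eq_0_iff[OF assms, of f] by (cases "f = 0") auto
  finally show ?thesis .
qed

lemma degree_grad_le_iff:
  assumes "finite J"
  shows "Polynomial.degree (grad J f) \<le> e \<longleftrightarrow> (\<forall>m\<in>keys f. wt J m \<le> e)"
proof
  assume *: "Polynomial.degree (grad J f) \<le> e"
  show "\<forall>m\<in>keys f. wt J m \<le> e"
  proof
    fix m assume "m \<in> keys f"
    then have "poly.coeff (grad J f) (wt J m) \<noteq> 0"
      using lookup_coeff_grad[OF assms, of f "wt J m" m] by (auto simp: in_keys_iff)
    then show "wt J m \<le> e" using * le_degree order_trans by blast
  qed
next
  assume *: "\<forall>m\<in>keys f. wt J m \<le> e"
  show "Polynomial.degree (grad J f) \<le> e"
  proof (rule degree_le, intro allI impI poly_mapping_eqI)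
    fix n m assume "e < n"
    then show "lookup (poly.coeff (grad J f) n) m = lookup 0 m"
      unfolding lookup_coeff_grad[OF assms] using * by (cases "m \<in> keys f") (force simp: when_def in_keys_iff)+
  qed
qed

lemma degree_mon_ev_le:
  fixes \<sigma> :: "nat \<Rightarrow> 'b::idom poly"
  assumes "finite J" "\<And>j. Polynomial.degree (\<sigma> j) \<le> (if j \<in> J then 1 else 0)"
  shows "Polynomial.degree (mon_ev \<sigma> m) \<le> wt J m"
proof -
  have "Polynomial.degree (mon_ev \<sigma> m) = Polynomial.degree (\<Prod>j\<in>keys m \<union> J. \<sigma> j ^ lookup m j)"
    by (subst mon_ev_superset[of "keys m \<union> J"]) (use assms in auto)
  also have "\<dots> \<le> (\<Sum>j\<in>keys m \<union> J. Polynomial.degree (\<sigma> j ^ lookup m j))"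
    by (rule order_trans[OF degree_prod_sum_le]) (use assms in auto)
  also have "\<dots> \<le> (\<Sum>j\<in>keys m \<union> J. if j \<in> J then lookup m j else 0)"
  proof (rule sum_mono)
    fix j
    have "Polynomial.degree (\<sigma> j ^ lookup m j) \<le> Polynomial.degree (\<sigma> j) * lookup m j"
      by (rule degree_power_le)
    also have "\<dots> \<le> (if j \<in> J then 1 else 0) * lookup m j"
      by (rule mult_right_mono[OF assms(2)]) simp
    finally show "Polynomial.degree (\<sigma> j ^ lookup m j) \<le> (if j \<in> J then lookup m j else 0)"
      by (simp split: if_splits)
  qed
  also have "\<dots> = wt J m"
    unfolding wt_def by (rule sum.mono_neutral_cong_right) (use assms in auto)
  finally show ?thesis .
qed

subsection \<open>Polynomials vanishing on a grid\<close>

lemma dvd_prod_diff: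
  fixes L :: "'a::comm_ring_1"
  assumes "\<And>j. L dvd \<sigma> j - \<tau> j"
  shows "L dvd prod \<sigma> A - prod \<tau> A"
proof (induction A rule: infinite_finite_induct)
  case (insert a A)
  have "prod \<sigma> (insert a A) - prod \<tau> (insert a A) =
      \<sigma> a * (prod \<sigma> A - prod \<tau> A) + (\<sigma> a - \<tau> a) * prod \<tau> A"
    using insert.hyps by (simp add: algebra_simps)
  then show ?case using insert.IH assms by (simp add: dvd_add)
qed auto

text \<open>Congruences are compatible with sums and products. For \<open>L\<close> = x_n - b x_0
  this is the factor theorem: a polynomial differs from its restriction to the hyperplane by a
  multiple of \<open>L\<close>.\<close>

lemma dvd_ev_diff:
  assumes "\<And>j. L dvd \<sigma> j - \<tau> j"
  shows "L dvd ev h \<sigma> f - ev h \<tau> f"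
proof -
  have "L dvd mon_ev \<sigma> m - mon_ev \<tau> m" for m
    unfolding mon_ev_def
  proof (rule dvd_prod_diff)
    fix j
    show "L dvd \<sigma> j ^ lookup m j - \<tau> j ^ lookup m j"
      using dvd_prod_diff[of L "\<lambda>_. \<sigma> j" "\<lambda>_. \<tau> j" "{..<lookup m j}"] assms by simp
  qed
  then show ?thesis
    unfolding ev_def sum_subtractf[symmetric] right_diff_distrib[symmetric]
    by (intro dvd_sum) simp
qed

text \<open>Split off one linear form by the factor theorem. It stays nonzero on each of the other
  hyperplanes, because the values a are distinct, so the quotient must still restrict to zero
  there.\<close>

lemma prod_linear_dvd:
  fixes g :: "'a::idom mpol"
  assumes "finite S" "n \<noteq> 0" "\<And>a. a \<in> S \<Longrightarrow> ev C (X(n := C a * X 0)) g = 0"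
  shows "(\<Prod>a\<in>S. X n - C a * X 0) dvd g"
  using assms(1,3)
proof (induction S arbitrary: g)
  case (insert b S)
  have "X n - C b * X 0 dvd ev C X g - ev C (X(n := C b * X 0)) g"
    by (rule dvd_ev_diff) simp
  then obtain g' where g': "g = (X n - C b * X 0) * g'"
    using insert.prems[of b] by (auto elim: dvdE)
  have "ev C (X(n := C a * X 0)) g' = 0" if "a \<in> S" for a
  proof -
    interpret E: rhom "ev C (X(n := C a * X 0))" by (intro rhom_ev rhom_C)
    interpret C: rhom "C :: 'a \<Rightarrow> _" by (rule rhom_C)
    have X: "X n - C b * X 0 = X n + C (- b) * X 0"
      by (simp add: C_def single_uminus)
    have "ev C (X(n := C a * X 0)) (X n - C b * X 0) = C (a - b) * X 0"
      unfolding X using assms(2) by (simp add: E.add E.mult ev_X ev_C diff_conv_add_uminus C.add distrib_right del: add_uminus_conv_diff)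
    moreover have "a - b \<noteq> 0" using that insert.hyps by auto
    ultimately have "ev C (X(n := C a * X 0)) (X n - C b * X 0) \<noteq> 0" by simp
    moreover have "ev C (X(n := C a * X 0)) (X n - C b * X 0) * ev C (X(n := C a * X 0)) g' = 0"
      using insert.prems[of a] that unfolding g' E.mult by blast
    ultimately show ?thesis by simp
  qed
  then have "(\<Prod>a\<in>S. X n - C a * X 0) dvd g'" by (rule insert.IH)
  then show ?case unfolding g' using insert.hyps by (simp add: mult_dvd_mono)
qed simp

lemma degree_ev_le:
  fixes \<sigma> :: "nat \<Rightarrow> 'b::idom poly"
  assumes "finite J" "\<And>j. Polynomial.degree (\<sigma> j) \<le> (if j \<in> J then 1 else 0)"
    and "\<And>a. Polynomial.degree (h a) = 0" "\<And>m. m \<in> keys f \<Longrightarrow> wt J m \<le> e"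
  shows "Polynomial.degree (ev h \<sigma> f) \<le> e"
  unfolding ev_def
proof (rule degree_sum_le)
  fix m assume m: "m \<in> keys f"
  have "Polynomial.degree (h (lookup f m) * mon_ev \<sigma> m) \<le> 0 + wt J m"
    using degree_mult_le[of "h (lookup f m)" "mon_ev \<sigma> m"] degree_mon_ev_le[OF assms(1,2)] assms(3)
    by (metis add_mono_thms_linordered_semiring(1) le_refl order_trans)
  then show "Polynomial.degree (h (lookup f m) * mon_ev \<sigma> m) \<le> e"
    using assms(4)[OF m] by simp
qed simp

lemma order_prod:
  fixes f :: "'b \<Rightarrow> 'a::idom poly"
  assumes "\<And>x. x \<in> A \<Longrightarrow> f x \<noteq> 0"
  shows "Polynomial.order c (prod f A) = (\<Sum>x\<in>A. Polynomial.order c (f x))"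
  using assms
proof (induction A rule: infinite_finite_induct)
  case (insert x A)
  then have "prod f A \<noteq> 0" by (auto simp: prod_zero_iff)
  then show ?case using insert by (simp add: order_mult)
qed (auto intro: order_0I)

text \<open>
  Restrict \<open>g\<close> to a hyperplane \<open>x\<^sub>n = a x\<^sub>0\<close> with \<open>a \<in> S\<close> and lower the dimension. If all these restrictions vanish,
  divide \<open>g\<close> by the product of the \<open>x\<^sub>n - a x\<^sub>0\<close>, which lowers \<open>e\<close> by \<open>card S\<close> and \<open>k\<close> by one.
\<close>

lemma grid_bound:
  fixes g :: "'a::idom mpol"
  assumes "finite J" "0 \<notin> J" "finite S" "g \<noteq> 0" "\<And>m. m \<in> keys g \<Longrightarrow> wt J m \<le> e"
    and "\<And>q. q 0 = 1 \<Longrightarrow> (\<And>j. j \<in> J \<Longrightarrow> q j \<in> S) \<Longrightarrow> vanish J k q g"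
  shows "card S * k \<le> e"
  using assms(1,2,4,5,6)
proof (induction J arbitrary: g k e)
  case empty
  \<comment> \<open>With no directions every weight is 0 and the shift at a point with zeroth
    coordinate 1 is the identity, so a nonzero \<open>g\<close> forces \<open>k = 0\<close>.\<close>
  have "shift {} (\<lambda>_. 1) g = ev C X g"
    unfolding shift_def by (rule ev_cong) simp
  then have "low {} k g" using empty.prems(4)[of "\<lambda>_. 1"] by (simp add: vanish_def)
  moreover obtain m where "m \<in> keys g" using empty.prems(2) by (metis equals0I keys_eq_empty)
  ultimately have "k = 0" by (auto simp: low_def wt_def)
  then show ?case by simp
next
  case (insert n J)
  let ?J = "insert n J"
  have fin: "finite ?J" using insert.hyps by simp
  show ?case using insert.prems
  proof (induction k arbitrary: g e)
    case (Suc k)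
    show ?case
    proof (cases "\<exists>a\<in>S. ev C (X(n := C a * X 0)) g \<noteq> 0")
      case True
      then obtain a where a: "a \<in> S" "ev C (X(n := C a * X 0)) g \<noteq> 0" by blast
      let ?g = "ev C (X(n := C a * X 0)) g"
      show ?thesis
      proof (rule insert.IH)
        show "0 \<notin> J" using insert.prems by simp
        show "?g \<noteq> 0" by fact
        \<comment> \<open>The replacement a x_0 of x_n has weight 0, so no weight grows.\<close>
        have "Polynomial.degree (grad J ?g) \<le> e"
          unfolding rhom_ev_comp[OF rhom_grad]
          by (rule degree_ev_le[OF fin])
            (use Suc.prems(1,3) in \<open>auto simp: grad_C grad_X rhom.mult[OF rhom_grad] one_pCons\<close>)
        then show "wt J m \<le> e" if "m \<in> keys ?g" for m
          using that insert.hyps by (simp add: degree_grad_le_iff)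
        fix q :: "nat \<Rightarrow> 'a" assume q: "q 0 = 1" "\<And>j. j \<in> J \<Longrightarrow> q j \<in> S"
        let ?q = "q(n := a)"
        have "low ?J (Suc k) (shift ?J ?q g)"
          unfolding vanish_def[symmetric] by (rule Suc.prems(4)) (use q a Suc.prems(1) in auto)
        \<comment> \<open>Restricting to x_n = a x_0 and then expanding at \<open>q\<close> is the
          same as expanding at the grid point \<open>?q\<close> of that hyperplane and then setting
          x_n = 0.\<close>
        moreover have sh: "shift J q ?g = ev C (X(n := 0)) (shift ?J ?q g)"
        proof -
          interpret E: rhom "ev C (X(n := 0)) :: 'a mpol \<Rightarrow> _" by (intro rhom_ev rhom_C)
          interpret S: rhom "shift J q" by (rule rhom_shift)
          have "shift J q ((X(n := C a * X 0)) j) = ev C (X(n := 0)) (shift ?J ?q (X j))" for j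
            using Suc.prems(1) q(1) insert.hyps
            by (auto simp: shift_X S.mult shift_C E.add E.mult ev_C ev_X)
          then show ?thesis
            unfolding shift_ev by (subst (2) ev_C_X[of g, symmetric]) (simp only: shift_ev ev_ev[OF rhom_C rhom_id])
        qed
        \<comment> \<open>Setting x_n = 0 only deletes monomials that contain x_n; on the remaining
          ones the weights for \<open>J\<close> and \<open>?J\<close> agree.\<close>
        moreover have "m \<in> keys f \<and> lookup m n = 0" if "m \<in> keys (ev C (X(n := 0)) f)" for f :: "'a mpol" and m
        proof -
          have "ev C (X(n := 0)) f = ev (\<lambda>c. C c) (\<lambda>j. C (((\<lambda>_. 1)(n := 0)) j) * X j) f"
            by (rule arg_cong[of _ _ "\<lambda>s. ev C s f"]) auto
          then have *: "lookup (ev C (X(n := 0)) f) m = lookup f m * mon_ev ((\<lambda>_. 1)(n := 0)) m"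
            by (simp only: lookup_ev_scale[of "\<lambda>x. x"])
          have "mon_ev ((\<lambda>_. 1::'a)(n := 0)) m = 0" if "lookup m n \<noteq> 0"
            unfolding mon_ev_def using that by (auto simp: in_keys_iff intro!: prod_zero)
          then show ?thesis using that * by (auto simp: in_keys_iff)
        qed
        ultimately show "vanish J (Suc k) q ?g"
          unfolding vanish_def low_def sh using insert.hyps by (fastforce simp: wt_def)
      qed
    next
      case False
      define P where "P = (\<Prod>a\<in>S. X n - C a * X 0)"
      interpret G: rhom "grad ?J :: 'a mpol \<Rightarrow> _" by (rule rhom_grad)
      have n: "n \<noteq> 0" using Suc.prems(1) by auto
      have "P dvd g"
        unfolding P_def by (rule prod_linear_dvd[OF \<open>finite S\<close> n]) (use False in auto)
      then obtain h where h: "g = P * h" by (auto elim: dvdE)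
      \<comment> \<open>In the grading variable every linear factor has degree one with leading
        coefficient \<open>X n\<close>, so the product \<open>P\<close> has degree
        \<open>card S\<close>.\<close>
      have grad_lin: "grad ?J (X n + C c * X 0) = [: C c * X 0, X n :]" for c :: 'a
        using Suc.prems(1) by (simp add: G.add G.mult grad_X grad_C one_pCons)
      have lin: "X n - C c * X 0 = X n + C (- c) * X 0" for c :: 'a
        by (simp add: C_def single_uminus)
      have P0: "P \<noteq> 0" and h0: "h \<noteq> 0" using Suc.prems(2) h by auto
      have "Polynomial.degree (grad ?J P) = card S"
        unfolding P_def lin G.prod grad_lin by (subst degree_prod_eq_sum_degree) simp_all
      moreover have "Polynomial.degree (grad ?J g) \<le> e"
        using Suc.prems(3) by (simp add: degree_grad_le_iff[OF fin])
      moreover have "Polynomial.degree (grad ?J g) = Polynomial.degree (grad ?J P) + Polynomial.degree (grad ?J h)"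
        unfolding h G.mult by (rule degree_mult_eq) (use P0 h0 grad_eq_0_iff[OF fin] in auto)
      ultimately have deg: "card S \<le> e" "Polynomial.degree (grad ?J h) \<le> e - card S" by auto
      have "card S * k \<le> e - card S"
      proof (rule Suc.IH)
        show "0 \<notin> ?J" "h \<noteq> 0" by fact+
        show "wt ?J m \<le> e - card S" if "m \<in> keys h" for m
          using that deg(2) by (simp add: degree_grad_le_iff[OF fin])
        fix q :: "nat \<Rightarrow> 'a" assume q: "q 0 = 1" "\<And>j. j \<in> ?J \<Longrightarrow> q j \<in> S"
        interpret S: rhom "shift ?J q" by (rule rhom_shift)
        have "shift ?J q (X n + C c * X 0) = X n + C (q n + c) * X 0" for c
          using n q(1) by (simp add: S.add S.mult shift_X shift_C rhom.add[OF rhom_C] distrib_right)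
        then have gP: "grad ?J (shift ?J q P) = (\<Prod>a\<in>S. [: C (q n - a) * X 0, X n :])"
          unfolding P_def lin S.prod G.prod by (simp add: grad_lin)
        \<comment> \<open>Among the parallel hyperplanes only the one with \<open>a = q n\<close>
          passes through \<open>q\<close>, so dividing by \<open>P\<close> costs at most one order
          there.\<close>
        have "Polynomial.order 0 [: C (q n - a) * X 0, X n :] = (if a = q n then 1 else 0)" for a
        proof (cases "a = q n")
          case True
          have "Polynomial.order 0 [: 0, X n :: 'a mpol :] = Polynomial.order 0 ([: 0, 1 :] * [: X n :: 'a mpol :])"
            by simp
          also have "\<dots> = Polynomial.order 0 [: 0, 1 :: 'a mpol :] + Polynomial.order 0 [: X n :: 'a mpol :]"
            by (rule order_mult) simp
          also have "\<dots> = 1"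
            using order_power_n_n[of "0 :: 'a mpol" 1] by (simp add: order_0I)
          finally show ?thesis using True by simp
        qed (auto intro: order_0I)
        then have ordP: "Polynomial.order 0 (grad ?J (shift ?J q P)) \<le> 1"
          unfolding gP by (subst order_prod) (use \<open>finite S\<close> in \<open>auto simp: sum.delta'\<close>)
        have "low ?J (Suc k) (shift ?J q P * shift ?J q h)"
          unfolding S.mult[symmetric] h[symmetric] vanish_def[symmetric] by (rule Suc.prems(4)) (use q in auto)
        then have *: "shift ?J q P * shift ?J q h = 0 \<or>
            Suc k \<le> Polynomial.order 0 (grad ?J (shift ?J q P) * grad ?J (shift ?J q h))"
          unfolding low_iff_order[OF fin] G.mult .
        have P1: "grad ?J (shift ?J q P) \<noteq> 0" unfolding gP using \<open>finite S\<close> by simp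
        show "vanish ?J k q h"
        proof (cases "shift ?J q h = 0")
          case False
          then have h1: "grad ?J (shift ?J q h) \<noteq> 0" by (simp add: grad_eq_0_iff[OF fin])
          have "shift ?J q P \<noteq> 0" using P1 G.zero by auto
          then have "Suc k \<le> Polynomial.order 0 (grad ?J (shift ?J q P)) + Polynomial.order 0 (grad ?J (shift ?J q h))"
            using * False order_mult[of "grad ?J (shift ?J q P)" "grad ?J (shift ?J q h)" 0] P1 h1 by simp
          then show ?thesis unfolding vanish_def low_iff_order[OF fin] using ordP by linarith
        qed (simp add: vanish_def)
      qed
      then show ?thesis using deg(1) by simp
    qed
  qed simp
qed

section \<open>Powers of the ideal of a point\<close>

definition subrng :: "'a::comm_ring_1 set \<Rightarrow> bool" where
  "subrng P \<longleftrightarrow> 0 \<in> P \<and> 1 \<in> P \<and> (\<forall>x\<in>P. - x \<in> P) \<and> (\<forall>x\<in>P. \<forall>y\<in>P. x + y \<in> P \<and> x * y \<in> P)"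

lemma subrng_sum: "subrng P \<Longrightarrow> (\<And>x. x \<in> A \<Longrightarrow> f x \<in> P) \<Longrightarrow> sum f A \<in> P"
  by (induction A rule: infinite_finite_induct) (auto simp: subrng_def)

lemma subrng_prod: "subrng P \<Longrightarrow> (\<And>x. x \<in> A \<Longrightarrow> f x \<in> P) \<Longrightarrow> prod f A \<in> P"
  by (induction A rule: infinite_finite_induct) (auto simp: subrng_def)

lemma subrng_power: "subrng P \<Longrightarrow> x \<in> P \<Longrightarrow> x ^ n \<in> P"
  by (induction n) (auto simp: subrng_def)

lemma subrng_mon_ev:
  "subrng P \<Longrightarrow> (\<And>j. j \<in> keys m \<Longrightarrow> \<sigma> j \<in> P) \<Longrightarrow> mon_ev \<sigma> m \<in> P"
  unfolding mon_ev_def by (intro subrng_prod subrng_power)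

lemma subrng_ev:
  assumes "subrng P" "\<And>m. m \<in> keys f \<Longrightarrow> h (lookup f m) \<in> P"
    and "\<And>m j. m \<in> keys f \<Longrightarrow> j \<in> keys m \<Longrightarrow> \<sigma> j \<in> P"
  shows "ev h \<sigma> f \<in> P"
  unfolding ev_def using subrng_mon_ev[OF assms(1,3)] assms(1,2)
  by (intro subrng_sum) (auto simp: subrng_def)

text \<open>For \<open>V = {..N}\<close> and \<open>F\<close> containing 0 this is the carrier of
  \<open>coord_ring F N\<close>. A general \<open>V\<close> also covers the polynomials in the
  indeterminates of finitely many generic points.\<close>

definition carr :: "'a::zero set \<Rightarrow> nat set \<Rightarrow> 'a mpol set" where
  "carr F V = {f. \<forall>m. lookup f m \<in> F \<and> (lookup f m \<noteq> 0 \<longrightarrow> keys m \<subseteq> V)}"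

lemma C_carr: "a \<in> F \<Longrightarrow> 0 \<in> F \<Longrightarrow> C a \<in> carr F V"
  by (auto simp: carr_def C_def lookup_single when_def)

lemma X_carr: "j \<in> V \<Longrightarrow> subrng F \<Longrightarrow> X j \<in> carr F V"
  by (auto simp: carr_def X_def lookup_single when_def subrng_def)

lemma subrng_carr:
  assumes F: "subrng F"
  shows "subrng (carr F V)"
  unfolding subrng_def
proof (intro conjI ballI)
  show "0 \<in> carr F V" "1 \<in> carr F V"
    using F by (auto simp: carr_def subrng_def lookup_one when_def)
  fix f assume f: "f \<in> carr F V"
  then show "- f \<in> carr F V" using F by (auto simp: carr_def subrng_def)
  fix g assume g: "g \<in> carr F V"
  have add: "f + g \<in> carr F V" if "f \<in> carr F V" "g \<in> carr F V" for f g
    unfolding carr_def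
  proof (intro CollectI allI conjI impI)
    fix m
    show "lookup (f + g) m \<in> F" using that F by (simp add: carr_def subrng_def lookup_add)
    assume "lookup (f + g) m \<noteq> 0"
    then have "lookup f m \<noteq> 0 \<or> lookup g m \<noteq> 0" by (auto simp: lookup_add)
    then show "keys m \<subseteq> V" using that by (auto simp: carr_def)
  qed
  then show "f + g \<in> carr F V" using f g .
  have "finite A \<Longrightarrow> (\<And>x. x \<in> A \<Longrightarrow> k x \<in> carr F V) \<Longrightarrow> sum k A \<in> carr F V" for k and A :: "mon set"
    by (induction A rule: finite_induct) (use \<open>0 \<in> carr F V\<close> add in auto)
  moreover have "Poly_Mapping.single (m + n) (lookup f m * lookup g n) \<in> carr F V"
    if "m \<in> keys f" "n \<in> keys g" for m n
  proof -
    have "keys m \<subseteq> V" "keys n \<subseteq> V" using that f g by (auto simp: carr_def in_keys_iff)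
    then have "keys (m + n) \<subseteq> V" using keys_add[of m n] by blast
    moreover have "lookup f m * lookup g n \<in> F" "0 \<in> F"
      using f g F by (auto simp: carr_def subrng_def)
    ultimately show ?thesis by (simp add: carr_def lookup_single when_def)
  qed
  moreover have "f * g = (\<Sum>m\<in>keys f. \<Sum>n\<in>keys g. Poly_Mapping.single (m + n) (lookup f m * lookup g n))"
    by (subst sum_singles[of f], subst sum_singles[of g]) (simp add: sum_product mult_single)
  ultimately show "f * g \<in> carr F V" by simp
qed

lemma carrD: "f \<in> carr F V \<Longrightarrow> m \<in> keys f \<Longrightarrow> keys m \<subseteq> V"
  by (auto simp: carr_def in_keys_iff)

section \<open>The coordinate ring over a subfield and the powers of point ideals\<close>

locale projective =
  fixes F :: "'a::field set" and N :: nat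
  assumes F: "subrng F" and inv_F: "\<And>x. x \<in> F \<Longrightarrow> inverse x \<in> F"
begin

abbreviation R :: "'a mpol ring" where "R \<equiv> coord_ring F N"

lemma R_simps [simp]: "mult R = (*)" "add R = (+)" "one R = 1" "zero R = 0"
  by (simp_all add: coord_ring_def)

lemma carrier_R: "carrier R = carr F {..N}"
proof -
  have "0 \<in> F" using F by (simp add: subrng_def)
  then show ?thesis by (auto simp: coord_ring_def carr_def in_keys_iff)
qed

lemma subrng_R: "subrng (carrier R)"
  unfolding carrier_R by (rule subrng_carr[OF F])

lemma R_closed:
  "0 \<in> carrier R" "1 \<in> carrier R" "x \<in> carrier R \<Longrightarrow> - x \<in> carrier R"
  "x \<in> carrier R \<Longrightarrow> y \<in> carrier R \<Longrightarrow> x + y \<in> carrier R"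
  "x \<in> carrier R \<Longrightarrow> y \<in> carrier R \<Longrightarrow> x * y \<in> carrier R"
  using subrng_R unfolding subrng_def by blast+

lemma cring_R: "cring R"
proof (rule cringI)
  show "abelian_group R"
  proof (rule abelian_groupI; unfold R_simps)
    fix x assume "x \<in> carrier R"
    then show "\<exists>y\<in>carrier R. y + x = 0"
      using R_closed(3) by (intro bexI[of _ "- x"]) simp_all
  qed (simp_all add: R_closed add_ac)
  show "comm_monoid R"
    by (rule comm_monoidI; unfold R_simps) (simp_all add: R_closed mult_ac)
qed (simp add: distrib_right)

sublocale cring R
  by (rule cring_R)

abbreviation J :: "nat set" where "J \<equiv> {Suc 0..N}"

lemma idealI':
  assumes "I \<subseteq> carrier R" "0 \<in> I" "\<And>x y. x \<in> I \<Longrightarrow> y \<in> I \<Longrightarrow> x + y \<in> I"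
    and "\<And>a x. a \<in> carrier R \<Longrightarrow> x \<in> I \<Longrightarrow> a * x \<in> I"
  shows "ideal I R"
proof (rule idealI)
  show "ring R" by (rule ring_axioms)
  show "subgroup I (add_monoid R)"
  proof (rule add.subgroupI)
    fix a assume a: "a \<in> I"
    then have "a \<in> carrier R" using assms(1) by auto
    moreover have "- a \<in> carrier R" using subrng_R \<open>a \<in> carrier R\<close> by (simp add: subrng_def)
    ultimately have "\<ominus>\<^bsub>R\<^esub> a = - a" by (intro minus_equality) simp_all
    moreover have "(- 1) * a \<in> I"
      using assms(4)[OF _ a, of "- 1"] subrng_R by (simp add: subrng_def)
    ultimately show "\<ominus>\<^bsub>R\<^esub> a \<in> I" by simp
  qed (use assms in auto)
  fix a x assume "a \<in> I" "x \<in> carrier R"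
  then have "x * a \<in> I" by (rule assms(4)[rotated])
  then show "x \<otimes>\<^bsub>R\<^esub> a \<in> I" "a \<otimes>\<^bsub>R\<^esub> x \<in> I" by (simp_all add: mult.commute[of a x])
qed

abbreviation pow_ideal :: "(nat \<Rightarrow> 'a) \<Rightarrow> nat \<Rightarrow> 'a mpol set" where
  "pow_ideal p m \<equiv> point_ideal F N p [^]\<^bsub>ideals_set R\<^esub> m"

lemma point_ideal_ideal: "ideal (point_ideal F N p) R"
  unfolding point_ideal_def by (rule genideal_ideal) auto

lemma ideals_set_simps:
  "carrier (ideals_set R) = {I. ideal I R}" "mult (ideals_set R) = ideal_prod R"
  "one (ideals_set R) = carrier R"
  by (simp_all add: ideals_set_def)

lemma point_ideal_carrier: "point_ideal F N p \<in> carrier (ideals_set R)"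
  unfolding ideals_set_simps using point_ideal_ideal by blast

lemma ideals_monoid: "monoid (ideals_set R)"
  by (rule comm_monoid.axioms(1)[OF ideals_set_is_comm_monoid])

lemma pow_ideal_ideal: "ideal (pow_ideal p m) R"
  using monoid.nat_pow_closed[OF ideals_monoid point_ideal_carrier, of p m]
  unfolding ideals_set_simps by blast

lemma pow_ideal_0: "pow_ideal p 0 = carrier R"
  using monoid.nat_pow_0[OF ideals_monoid] unfolding ideals_set_simps .

lemma one_pow_ideal: "1 \<in> pow_ideal p 0"
  unfolding pow_ideal_0 by (rule R_closed)

lemma pow_ideal_add: "pow_ideal p (m + n) = ideal_prod R (pow_ideal p m) (pow_ideal p n)"
  using monoid.nat_pow_mult[OF ideals_monoid point_ideal_carrier, of p m n]
  unfolding ideals_set_simps by (rule sym)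

lemma pow_ideal_1: "pow_ideal p (Suc 0) = point_ideal F N p"
  using monoid.nat_pow_Suc2[OF ideals_monoid point_ideal_carrier, of p 0]
    ideal_prod_one[OF point_ideal_ideal]
  unfolding pow_ideal_0 ideals_set_simps by (rule trans)

lemma pow_ideal_mult: "f \<in> pow_ideal p m \<Longrightarrow> g \<in> pow_ideal p n \<Longrightarrow> f * g \<in> pow_ideal p (m + n)"
  unfolding pow_ideal_add using ideal_prod.prod[of f "pow_ideal p m" g "pow_ideal p n" R] by simp

lemma pow_ideal_antimono:
  assumes "m \<le> n" shows "pow_ideal p n \<subseteq> pow_ideal p m"
proof -
  obtain k where "n = m + k" using assms le_Suc_ex by blast
  then show ?thesis
    using ideal_prod_inter[OF pow_ideal_ideal pow_ideal_ideal, of p m p k] by (simp add: pow_ideal_add)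
qed

lemma pow_ideal_carr: "f \<in> pow_ideal p m \<Longrightarrow> f \<in> carrier R"
  using ideal.Icarr[OF pow_ideal_ideal] .

lemma pow_ideal_lmult: "a \<in> carrier R \<Longrightarrow> f \<in> pow_ideal p m \<Longrightarrow> a * f \<in> pow_ideal p m"
  using ideal.I_l_closed[OF pow_ideal_ideal] by simp

lemma pow_ideal_zero: "0 \<in> pow_ideal p m"
  using additive_subgroup.zero_closed[OF ideal.axioms(1)[OF pow_ideal_ideal]] by simp

lemma pow_ideal_plus: "f \<in> pow_ideal p m \<Longrightarrow> g \<in> pow_ideal p m \<Longrightarrow> f + g \<in> pow_ideal p m"
  using additive_subgroup.a_closed[OF ideal.axioms(1)[OF pow_ideal_ideal]] by simp

lemma pow_ideal_sum: "(\<And>x. x \<in> A \<Longrightarrow> f x \<in> pow_ideal p m) \<Longrightarrow> sum f A \<in> pow_ideal p m"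
  by (induction A rule: infinite_finite_induct) (auto simp: pow_ideal_zero pow_ideal_plus)

lemma pow_ideal_power: "f \<in> pow_ideal p m \<Longrightarrow> f ^ n \<in> pow_ideal p (m * n)"
proof (induction n)
  case 0
  show ?case unfolding power_0 mult_0_right by (rule one_pow_ideal)
next
  case (Suc n)
  then show ?case using pow_ideal_mult[of f p m "f ^ n" "m * n"] by simp
qed

lemma pow_ideal_prod:
  "(\<And>x. x \<in> A \<Longrightarrow> f x \<in> pow_ideal p (e x)) \<Longrightarrow> prod f A \<in> pow_ideal p (sum e A)"
proof (induction A rule: infinite_finite_induct)
  case (insert x A)
  then show ?case using pow_ideal_mult[of "f x" p "e x" "prod f A" "sum e A"] by simp
qed (simp_all only: prod.infinite sum.infinite prod.empty sum.empty one_pow_ideal not_False_eq_True)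

lemma shift_carr:
  assumes "f \<in> carrier R" "\<And>j. j \<le> N \<Longrightarrow> p j \<in> F"
  shows "shift J p f \<in> carrier R"
  unfolding shift_def
proof (rule subrng_ev[OF subrng_R])
  have 0: "0 \<in> F" using F by (simp add: subrng_def)
  show "C (lookup f m) \<in> carrier R" for m
    using assms(1) 0 unfolding carrier_R by (intro C_carr) (auto simp: carr_def)
  fix m j assume "m \<in> keys f" "j \<in> keys m"
  then have "j \<le> N" using carrD[of f F "{..N}" m] assms(1) by (auto simp: carrier_R)
  moreover have X: "X i \<in> carrier R" if "i \<le> N" for i
    using that X_carr[OF _ F] by (auto simp: carrier_R)
  moreover have "C (p i) \<in> carrier R" if "i \<le> N" for i
    unfolding carrier_R by (intro C_carr assms 0 that)
  ultimately show "(if j = 0 then C (p 0) * X 0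
                         else if j \<in> J then C (p j) * X 0 + X j else X j) \<in> carrier R"
    using subrng_R unfolding subrng_def by auto
qed

text \<open>Killing all variables except x_0 after the shift turns a form \<open>f\<close> of degree
  \<open>d\<close> into f(p) x_0^d, by homogeneity. If f(p) = 0, no pure power of x_0 survives in
  the shifted form, and every other monomial in x_0, ..., x_N has positive weight.\<close>

lemma vanish_generator:
  assumes f: "f \<in> carrier R" and hom: "homogeneous d f" and ev0: "eval_at p f = 0"
  shows "vanish J 1 p f"
proof -
  let ?\<kappa> = "ev C (\<lambda>j. C (if j = 0 then 1 else 0 :: 'a) * X j) :: 'a mpol \<Rightarrow> 'a mpol"
  interpret \<kappa>: rhom ?\<kappa> by (intro rhom_ev rhom_C)
  have "?\<kappa> (shift J p f) = ev (\<lambda>a. ?\<kappa> (C a)) (\<lambda>j. ?\<kappa> (if j = 0 then C (p 0) * X 0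
        else if j \<in> J then C (p j) * X 0 + X j else X j)) f"
    unfolding shift_def by (rule rhom_ev_comp) (rule \<kappa>.rhom_axioms)
  also have "\<dots> = ev C (\<lambda>j. ?\<kappa> (if j = 0 then C (p 0) * X 0
        else if j \<in> J then C (p j) * X 0 + X j else X j)) f"
    by (simp add: ev_C)
  also have "\<dots> = ev C (\<lambda>j. C (p j) * X 0) f"
  proof (rule ev_cong)
    fix m j assume "m \<in> keys f" "j \<in> keys m"
    then have "j \<le> N" using f carrD[of f F "{..N}" m] by (auto simp: carrier_R)
    have \<kappa>_X: "?\<kappa> (X i) = C (if i = 0 then 1 else 0) * X i" for i by (rule ev_X) simp_all
    have \<kappa>_C: "?\<kappa> (C a) = C a" for a by (rule ev_C) simp
    show "?\<kappa> (if j = 0 then C (p 0) * X 0 else if j \<in> J then C (p j) * X 0 + X j else X j)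
        = C (p j) * X 0"
      using \<open>j \<le> N\<close> by (simp add: \<kappa>.add \<kappa>.mult \<kappa>_X \<kappa>_C)
  qed
  also have "\<dots> = (\<Sum>m\<in>keys f. C (lookup f m * mon_ev p m) * X 0 ^ d)"
    unfolding ev_def
  proof (rule sum.cong[OF refl])
    fix m assume "m \<in> keys f"
    then have "mon_degree m = d" using hom by (simp add: homogeneous_def)
    then have "mon_ev (\<lambda>j. X 0) m = (X 0 ^ d :: 'a mpol)"
      unfolding mon_ev_def mon_degree_def by (simp only: power_sum[symmetric])
    then show "C (lookup f m) * mon_ev (\<lambda>j. C (p j) * X 0) m = C (lookup f m * mon_ev p m) * X 0 ^ d"
      by (simp add: mon_ev_mult rhom_mon_ev[OF rhom_C] rhom.mult[OF rhom_C])
  qed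
  also have "\<dots> = C (\<Sum>m\<in>keys f. lookup f m * mon_ev p m) * X 0 ^ d"
    by (simp add: rhom.sum[OF rhom_C] sum_distrib_right)
  also have "(\<Sum>m\<in>keys f. lookup f m * mon_ev p m) = 0"
    using ev0 by (simp add: eval_at_def mon_ev_def)
  finally have \<kappa>0: "?\<kappa> (shift J p f) = 0" by simp
  have "1 \<le> wt J m" if "m \<in> keys (shift J p f)" for m
  proof (rule ccontr)
    assume "\<not> 1 \<le> wt J m"
    then have wt: "\<forall>j\<in>J. lookup m j = 0" by (simp add: wt_def not_le)
    \<comment> \<open>The coordinates of \<open>p\<close> are not assumed to lie in
      \<open>F\<close>, so the variables of the shifted form are bounded over the whole ambient
      field.\<close>
    interpret U: projective UNIV N by standard (auto simp: subrng_def)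
    have "f \<in> carrier U.R" using f unfolding carrier_R U.carrier_R by (auto simp: carr_def)
    then have "keys m \<subseteq> {..N}"
      using carrD[OF U.shift_carr[unfolded U.carrier_R]] that U.carrier_R by blast
    have "keys m \<subseteq> {0}"
    proof (intro subsetI)
      fix i assume "i \<in> keys m"
      then have "i \<le> N" "lookup m i \<noteq> 0" using \<open>keys m \<subseteq> {..N}\<close> by (blast, simp add: in_keys_iff)
      then have "i \<notin> J" using wt by metis
      then show "i \<in> {0}" using \<open>i \<le> N\<close> by simp
    qed
    then have "mon_ev (\<lambda>j. if j = 0 then 1 else 0 :: 'a) m = 1"
      by (subst mon_ev_superset[of "{0}"]) auto
    then have "lookup (?\<kappa> (shift J p f)) m = lookup (shift J p f) m"
      by (simp add: lookup_ev_scale[of "\<lambda>x. x"])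
    then show False using \<kappa>0 that by (simp add: in_keys_iff)
  qed
  then show ?thesis by (simp add: vanish_def low_def)
qed

text \<open>The polynomials of order at least one form an ideal that contains the generators of the
  point ideal, and orders of vanishing add up in products.\<close>

lemma pow_ideal_vanish:
  assumes "f \<in> pow_ideal p m"
  shows "vanish J m p f"
  using assms
proof (induction m arbitrary: f)
  case 0
  show ?case by (simp add: vanish_def)
next
  case (Suc m)
  interpret S: rhom "shift J p" by (rule rhom_shift)
  have "point_ideal F N p \<subseteq> {f \<in> carrier R. vanish J 1 p f}"
    unfolding point_ideal_def
  proof (rule genideal_minimal)
    show "ideal {f \<in> carrier R. vanish J 1 p f} R"
    proof (rule idealI')
      fix a x assume "a \<in> carrier R" "x \<in> {f \<in> carrier R. vanish J 1 p f}"
      then show "a * x \<in> {f \<in> carrier R. vanish J 1 p f}"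
        using subrng_R low_mult[of J 0 "shift J p a" 1 "shift J p x"]
        by (auto simp: vanish_def subrng_def S.mult)
    qed (use subrng_R in \<open>auto simp: vanish_def S.zero S.add low_add subrng_def\<close>)
    show "{f \<in> carrier R. (\<exists>d. homogeneous d f) \<and> eval_at p f = 0} \<subseteq> {f \<in> carrier R. vanish J 1 p f}"
      using vanish_generator by auto
  qed
  then have 1: "vanish J 1 p f" if "f \<in> pow_ideal p (Suc 0)" for f
    using that unfolding pow_ideal_1 by auto
  have "f \<in> ideal_prod R (pow_ideal p m) (pow_ideal p (Suc 0))"
    using Suc.prems pow_ideal_add[of p m "Suc 0"] by simp
  then show ?case
  proof (induction rule: ideal_prod.induct)
    case (prod i j)
    then show ?case
      using low_mult[of J m "shift J p i" 1 "shift J p j"] Suc.IH 1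
      by (simp add: vanish_def S.mult)
  next
    case (sum s1 s2)
    then show ?case by (simp add: vanish_def S.add low_add)
  qed
qed

text \<open>As p_0 is invertible, the shift is undone by the substitution \<open>\<tau>\<close>,
  which sends x_j with \<open>j \<in> J\<close> to the linear form x_j - (p_j / p_0) x_0 through
  \<open>p\<close>. Undoing the shift writes \<open>f\<close> as a combination of products with at
  least \<open>M\<close> such forms.\<close>

lemma vanish_pow_ideal:
  assumes f: "f \<in> carrier R" and p: "\<And>j. j \<le> N \<Longrightarrow> p j \<in> F" "p 0 \<noteq> 0" and v: "vanish J M p f"
  shows "f \<in> pow_ideal p M"
proof -
  define c where "c j = p j * inverse (p 0)" for j
  define \<tau> where "\<tau> = (\<lambda>j. if j = 0 then C (inverse (p 0)) * X 0
    else if j \<in> J then X j + C (- c j) * X 0 else X j)"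
  interpret T: rhom "ev C \<tau>" by (intro rhom_ev rhom_C)
  have 0: "0 \<in> F" using F by (simp add: subrng_def)
  have carr_X: "X i \<in> carrier R" if "i \<le> N" for i
    using that X_carr[OF _ F] by (auto simp: carrier_R)
  have carr_C: "C a \<in> carrier R" if "a \<in> F" for a
    unfolding carrier_R by (intro C_carr 0 that)
  have cF: "- c j \<in> F" if "j \<le> N" for j
    using that p(1) inv_F F unfolding c_def subrng_def by blast
  have \<tau>0: "\<tau> 0 \<in> carrier R"
    unfolding \<tau>_def using inv_F p by (auto intro!: R_closed carr_C carr_X)
  have \<tau>J: "\<tau> j \<in> pow_ideal p (Suc 0)" if j: "j \<in> J" for j
  proof -
    have \<tau>: "\<tau> j = X j + C (- c j) * X 0" using j by (simp add: \<tau>_def)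
    have inR: "\<tau> j \<in> carrier R"
      unfolding \<tau> using j by (intro R_closed carr_C carr_X cF) auto
    have ev_eq: "eval_at p g = ev (\<lambda>x. x) p g" for g
      by (simp add: eval_at_def ev_def mon_ev_def)
    interpret E: rhom "ev (\<lambda>x. x) p" by (intro rhom_ev rhom_id)
    have "eval_at p (\<tau> j) = 0"
      unfolding ev_eq \<tau> using p(2) by (simp add: E.add E.mult ev_C ev_X c_def)
    moreover have "homogeneous 1 (\<tau> j)"
    proof -
      have "keys (\<tau> j) \<subseteq> {Poly_Mapping.single j 1, Poly_Mapping.single 0 1}"
        unfolding \<tau> X_def C_def mult_single
        by (intro order_trans[OF keys_add]) (auto split: if_splits)
      then show ?thesis by (auto simp: homogeneous_def mon_degree_def)
    qed
    ultimately have "\<tau> j \<in> {f \<in> carrier R. (\<exists>d. homogeneous d f) \<and> eval_at p f = 0}"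
      using inR by (intro CollectI conjI exI[of _ 1])
    then show ?thesis
      unfolding pow_ideal_1 unfolding point_ideal_def
      by (rule subsetD[OF genideal_self, rotated]) (rule Collect_subset)
  qed
  \<comment> \<open>That \<open>\<tau>\<close> inverts the shift is checked on the
    variables.\<close>
  have "ev C \<tau> (shift J p f) = ev C (\<lambda>j. ev C \<tau> (shift J p (X j))) f"
    by (subst (1) ev_C_X[of f, symmetric], simp only: shift_ev ev_ev[OF rhom_C rhom_id])
  also have "\<dots> = ev C X f"
  proof (rule ev_cong)
    have p0: "C (p 0) * C (inverse (p 0)) = 1" using p(2) by (simp flip: rhom.mult[OF rhom_C])
    have cancel: "C (p j) * C (inverse (p 0)) + C (- c j) = 0" for j
      by (simp add: c_def flip: rhom.mult[OF rhom_C] rhom.add[OF rhom_C])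
    have pj: "C (p j) * (C (inverse (p 0)) * X 0) + (X j + C (- c j) * X 0) = X j" for j
    proof -
      have "C (p j) * (C (inverse (p 0)) * X 0) + (X j + C (- c j) * X 0) =
          X j + (C (p j) * C (inverse (p 0)) + C (- c j)) * X 0"
        by (simp only: algebra_simps)
      then show ?thesis unfolding cancel by simp
    qed
    have T_X: "ev C \<tau> (X i) = \<tau> i" for i by (rule ev_X) simp_all
    have T_C: "ev C \<tau> (C a) = C a" for a by (rule ev_C) simp
    show "ev C \<tau> (shift J p (X j)) = X j" for j
    proof -
      have \<tau>_0: "\<tau> 0 = C (inverse (p 0)) * X 0"
        and \<tau>_J: "j \<in> J \<Longrightarrow> \<tau> j = X j + C (- c j) * X 0"
        and \<tau>_else: "j \<noteq> 0 \<Longrightarrow> j \<notin> J \<Longrightarrow> \<tau> j = X j" by (simp_all add: \<tau>_def)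
      consider "j = 0" | "j \<in> J" | "j \<noteq> 0" "j \<notin> J" by blast
      then show ?thesis
      proof cases
        case 1
        have "ev C \<tau> (shift J p (X j)) = C (p 0) * \<tau> 0"
          unfolding shift_X 1 by (simp only: simp_thms if_True T.mult T_X T_C)
        also have "\<dots> = (C (p 0) * C (inverse (p 0))) * X 0"
          unfolding \<tau>_0 by (rule mult.assoc[symmetric])
        finally show ?thesis unfolding p0 1 by simp
      next
        case 2
        then have "shift J p (X j) = C (p j) * X 0 + X j" by (simp add: shift_X)
        then have "ev C \<tau> (shift J p (X j)) = C (p j) * \<tau> 0 + \<tau> j"
          by (simp only: T.add T.mult T_X T_C)
        also have "\<dots> = X j" unfolding \<tau>_0 \<tau>_J[OF 2] by (rule pj)
        finally show ?thesis .
      next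
        case 3
        then have "shift J p (X j) = X j" by (simp add: shift_X)
        then show ?thesis using \<tau>_else[OF 3] by (simp only: T_X)
      qed
    qed
  qed
  finally have "f = ev C \<tau> (shift J p f)" by simp
  also have "\<dots> \<in> pow_ideal p M"
    unfolding ev_def
  proof (rule pow_ideal_sum)
    fix m assume m: "m \<in> keys (shift J p f)"
    have sh: "shift J p f \<in> carr F {..N}" using shift_carr[OF f p(1)] by (simp add: carrier_R)
    then have V: "keys m \<subseteq> {..N}" using m by (rule carrD)
    have "mon_ev \<tau> m = (\<Prod>j\<le>N. \<tau> j ^ lookup m j)"
      by (rule mon_ev_superset) (use V in auto)
    also have "{..N} = insert 0 J" by auto
    also have "(\<Prod>j\<in>\<dots>. \<tau> j ^ lookup m j) = \<tau> 0 ^ lookup m 0 * (\<Prod>j\<in>J. \<tau> j ^ lookup m j)"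
      by (subst prod.insert) auto
    finally have *: "mon_ev \<tau> m = \<tau> 0 ^ lookup m 0 * (\<Prod>j\<in>J. \<tau> j ^ lookup m j)" .
    have "(\<Prod>j\<in>J. \<tau> j ^ lookup m j) \<in> pow_ideal p (wt J m)"
      unfolding wt_def using pow_ideal_power[OF \<tau>J] by (intro pow_ideal_prod) auto
    moreover have "M \<le> wt J m" using v m by (simp add: vanish_def low_def)
    ultimately have "(\<Prod>j\<in>J. \<tau> j ^ lookup m j) \<in> pow_ideal p M" using pow_ideal_antimono by blast
    then show "C (lookup (shift J p f) m) * mon_ev \<tau> m \<in> pow_ideal p M"
      unfolding * using sh \<tau>0
      by (intro pow_ideal_lmult carr_C subrng_power[OF subrng_R]) (auto simp: carr_def)
  qed
  finally show ?thesis .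
qed

end

section \<open>Points at which a polynomial does not vanish\<close>

text \<open>In a finite field, one plus the product of all x - a takes the value 1 everywhere and so
  has no root.\<close>

lemma infinite_UNIV_alg_closed: "infinite (UNIV :: 'a::alg_closed_field set)"
proof
  assume fin: "finite (UNIV :: 'a set)"
  let ?q = "\<Prod>a\<in>UNIV. [:- a, 1 :: 'a:]"
  have "Polynomial.degree ?q = card (UNIV :: 'a set)"
    by (subst degree_prod_eq_sum_degree) simp_all
  then have "Polynomial.degree (?q + 1) = card (UNIV :: 'a set)"
    using fin by (subst degree_add_eq_left) (auto simp: card_gt_0_iff)
  then have "Polynomial.degree (?q + 1) > 0" using fin by (simp add: card_gt_0_iff)
  then obtain x where "poly (?q + 1) x = 0" using alg_closed_imp_poly_has_root by blast
  moreover have "poly ?q x = 0" using fin by (auto simp: poly_prod prod_zero_iff)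
  ultimately show False by simp
qed

lemma rhom_poly: "rhom (\<lambda>p. poly p a)"
  by standard simp_all

lemma subrng_UNIV: "subrng UNIV"
  by (simp add: subrng_def)

text \<open>Induction on the variables: seen as a univariate polynomial in x_n, \<open>f\<close> has
  only finitely many roots, so some constant from the infinite field can replace x_n without making
  it zero.\<close>

lemma exists_nonvanishing_point:
  fixes f :: "'a::field mpol"
  assumes inf: "infinite (UNIV :: 'a set)" and "f \<noteq> 0"
  shows "\<exists>\<zeta>. ev (\<lambda>x. x) \<zeta> f \<noteq> 0"
proof -
  have "\<exists>\<zeta>. ev (\<lambda>x. x) \<zeta> f \<noteq> 0" if "finite V" "f \<in> carr UNIV V" "f \<noteq> 0" for V and f :: "'a mpol"
    using that
  proof (induction V arbitrary: f)
    case empty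
    then have keys: "keys f \<subseteq> {0}" using carrD[OF empty.prems(1)] by fastforce
    moreover have "keys f \<noteq> {}" using empty.prems(2) by (metis keys_eq_empty)
    ultimately have "0 \<in> keys f" by blast
    have "ev (\<lambda>x. x) (\<lambda>_. 0) f = lookup f 0"
      by (subst ev_superset[of "{0}"]) (use keys in auto)
    then show ?case using \<open>0 \<in> keys f\<close> by (intro exI[of _ "\<lambda>_. 0"]) (simp add: in_keys_iff)
  next
    case (insert n V)
    define H where "H = ev (\<lambda>a. [:C a:]) (\<lambda>j. if j = n then [:0, 1:] else [:X j:]) f"
    have poly_H: "poly H x = ev C (X(n := x)) f" for x
    proof -
      have "poly H x = ev (\<lambda>a. poly [:C a:] x) (\<lambda>j. poly (if j = n then [:0, 1:] else [:X j:]) x) f"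
        unfolding H_def by (rule rhom_ev_comp[OF rhom_poly])
      also have "\<dots> = ev C (X(n := x)) f"
        by (rule arg_cong2[of _ _ _ _ "\<lambda>h s. ev h s f"]) auto
      finally show ?thesis .
    qed
    \<comment> \<open>Evaluating \<open>H\<close> at x_n itself returns \<open>f\<close>.\<close>
    have "H \<noteq> 0" using poly_H[of "X n"] insert.prems(2) by auto
    then have "finite {x. poly H x = 0}" by (rule poly_roots_finite)
    moreover have "infinite (range (C :: 'a \<Rightarrow> _))" using inf by (simp add: finite_image_iff[OF inj_C])
    ultimately have "\<not> range C \<subseteq> {x. poly H x = 0}" using finite_subset by blast
    then obtain a where a: "poly H (C a) \<noteq> 0" by auto
    let ?f = "ev C (X(n := C a)) f"
    have "?f \<in> carr UNIV V"
    proof (rule subrng_ev[OF subrng_carr[OF subrng_UNIV]])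
      fix m j assume "m \<in> keys f" "j \<in> keys m"
      then have "j \<in> insert n V" using carrD[OF insert.prems(1)] by blast
      then show "(X(n := C a)) j \<in> carr UNIV V"
        using X_carr[OF _ subrng_UNIV] C_carr[of a UNIV] by auto
    qed (simp add: C_carr)
    then obtain \<zeta> where \<zeta>: "ev (\<lambda>x. x) \<zeta> ?f \<noteq> 0"
      using insert.IH[of ?f] a poly_H by auto
    have "ev (\<lambda>x. x) \<zeta> ?f = ev (\<lambda>x. x) (\<lambda>j. ev (\<lambda>x. x) \<zeta> ((X(n := C a)) j)) f"
      using ev_ev[OF rhom_id rhom_id] .
    then show ?case using \<zeta> by auto
  qed
  moreover have "f \<in> carr UNIV (\<Union>m\<in>keys f. keys m)"
    by (auto simp: carr_def in_keys_iff)
  ultimately show ?thesis using assms(2) by (meson finite_UN finite_keys)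
qed

section \<open>Leading coefficients in a parameter\<close>

lemma lookup_C_mult: "lookup (C a * f) m = a * lookup f m"
  for a :: "'a::comm_ring_1"
proof -
  have "C a * f = (\<Sum>n\<in>keys f. Poly_Mapping.single n (a * lookup f n))"
    by (subst sum_singles[of f]) (simp add: C_def sum_distrib_left mult_single)
  then show ?thesis
    by (auto simp: lookup_sum lookup_single when_def sum.delta in_keys_iff)
qed

lemma keys_C_mult: "a \<noteq> 0 \<Longrightarrow> keys (C a * f) = keys f"
  for a :: "'a::idom"
  by (auto simp: in_keys_iff lookup_C_mult)

lemma vanish_C_mult: "a \<noteq> 0 \<Longrightarrow> vanish J k p (C a * f) \<longleftrightarrow> vanish J k p f"
  for a :: "'a::idom"
  by (simp add: vanish_def low_def rhom.mult[OF rhom_shift] shift_C keys_C_mult)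

lemma C_mult_exists:
  fixes f :: "'a::comm_ring_1 mpol"
  assumes "\<And>m. m \<in> keys f \<Longrightarrow> a dvd lookup f m"
  obtains g where "f = C a * g"
proof -
  obtain d where d: "\<And>m. m \<in> keys f \<Longrightarrow> lookup f m = a * d m"
    using assms unfolding dvd_def by metis
  have "C a * (\<Sum>m\<in>keys f. Poly_Mapping.single m (d m)) = (\<Sum>m\<in>keys f. Poly_Mapping.single m (lookup f m))"
    by (simp add: sum_distrib_left C_def mult_single d)
  then show ?thesis using that sum_singles[of f] by metis
qed

abbreviation T :: "'a::comm_ring_1 poly" where "T \<equiv> [:0, 1:]"

lemma T_power_dvd: "T ^ k dvd p \<longleftrightarrow> p = 0 \<or> k \<le> Polynomial.order 0 p" for p :: "'a::idom poly"
  using order_divides[of 0 k p] by simp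

lemma order_T_power_mult:
  "p \<noteq> 0 \<Longrightarrow> Polynomial.order 0 (T ^ k * p) = k + Polynomial.order 0 p" for p :: "'a::idom poly"
  using order_power_n_n[of "0 :: 'a" k] by (subst order_mult) auto

lemma order_eq_0_iff_poly: "p \<noteq> 0 \<Longrightarrow> Polynomial.order 0 p = 0 \<longleftrightarrow> poly p 0 \<noteq> 0" for p :: "'a::idom poly"
  using order_root[of p 0] by auto

text \<open>Take \<open>c\<close> as the least order in t among all coefficients: a coefficient
  attaining it becomes nonzero at t = 0 after division by t^c.\<close>

lemma leading_coefficient_exists:
  fixes f :: "'a::idom poly mpol"
  assumes "f \<noteq> 0"
  obtains c g where "f = C (T ^ c) * g" "mapc (\<lambda>p. poly p 0) g \<noteq> 0"
proof -
  let ?o = "\<lambda>m. Polynomial.order 0 (lookup f m)"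
  have ne: "finite (?o ` keys f)" "?o ` keys f \<noteq> {}"
    using assms by simp_all
  define c where "c = Min (?o ` keys f)"
  have "T ^ c dvd lookup f m" if "m \<in> keys f" for m
    unfolding T_power_dvd c_def using that ne by auto
  then obtain g where g: "f = C (T ^ c) * g" by (rule C_mult_exists)
  obtain m where m: "m \<in> keys f" "?o m = c"
    using Min_in[OF ne] unfolding c_def by auto
  have "lookup g m \<noteq> 0" using m(1) unfolding g by (auto simp: in_keys_iff lookup_C_mult)
  then have "poly (lookup g m) 0 \<noteq> 0"
    using m(2) order_T_power_mult[of "lookup g m" c]
    by (simp add: g lookup_C_mult flip: order_eq_0_iff_poly)
  then have "lookup (mapc (\<lambda>p. poly p 0) g) m \<noteq> 0" by (simp add: lookup_mapc)
  then have "mapc (\<lambda>p. poly p 0) g \<noteq> 0" by (metis lookup_zero)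
  then show ?thesis using g that by blast
qed

section \<open>Collision of points with prescribed directions\<close>

lemma shift_cong:
  "(\<And>j. j \<in> insert 0 J \<Longrightarrow> p j = p' j) \<Longrightarrow> shift J p = shift J p'"
  unfolding shift_def by (rule arg_cong[of _ _ "ev C"]) auto

lemma vanish_cong:
  "(\<And>j. j \<in> insert 0 J \<Longrightarrow> p j = p' j) \<Longrightarrow> vanish J k p f \<longleftrightarrow> vanish J k p' f"
  unfolding vanish_def using shift_cong[of J p p'] by simp

text \<open>Expanding at z, zooming in by t and expanding at the direction v amounts to expanding at
  p = c (z + t v), up to scaling the variables; \<open>d\<close> undoes the factor c on x_0. Scaling
  creates no new monomials, so the order at p becomes an order at v.\<close>

lemma rescaling_shift:
  fixes f :: "'a::comm_ring_1 mpol"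
  assumes "0 \<notin> J" "c * d = 1" "p 0 = c * z 0" "\<And>j. j \<in> J \<Longrightarrow> p j = c * (z j + t * v j)" "v 0 = 1"
  shows "shift J v (ev C (\<lambda>j. C (if j \<in> J then t else 1) * X j) (shift J z f)) =
    ev C (\<lambda>j. C (if j = 0 then d else if j \<in> J then t else 1) * X j) (shift J p f)"
proof -
  let ?\<theta> = "ev C (\<lambda>j. C (if j \<in> J then t else 1) * X j) :: 'a mpol \<Rightarrow> _"
  let ?\<psi> = "ev C (\<lambda>j. C (if j = 0 then d else if j \<in> J then t else 1) * X j) :: 'a mpol \<Rightarrow> _"
  interpret \<theta>: rhom ?\<theta> by (intro rhom_ev rhom_C)
  interpret \<psi>: rhom ?\<psi> by (intro rhom_ev rhom_C)
  interpret S: rhom "shift J v" by (rule rhom_shift)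
  interpret C: rhom "C :: 'a \<Rightarrow> _" by (rule rhom_C)
  have \<theta>X: "?\<theta> (X j) = C (if j \<in> J then t else 1) * X j" for j by (rule ev_X) simp_all
  have \<psi>X: "?\<psi> (X j) = C (if j = 0 then d else if j \<in> J then t else 1) * X j" for j
    by (rule ev_X) simp_all
  have \<theta>C: "?\<theta> (C a) = C a" for a by (rule ev_C) simp
  have \<psi>C: "?\<psi> (C a) = C a" for a by (rule ev_C) simp
  have "shift J v (?\<theta> (shift J z (X j))) = ?\<psi> (shift J p (X j))" for j
  proof -
    consider "j = 0" | "j \<noteq> 0" "j \<in> J" | "j \<noteq> 0" "j \<notin> J" by blast
    then show ?thesis
    proof cases
      case 1
      have "shift J v (?\<theta> (shift J z (X j))) = C (z 0) * X 0"
        using 1 assms(1,5) by (simp add: shift_X \<theta>.mult \<theta>X \<theta>C S.mult shift_C)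
      moreover have "?\<psi> (shift J p (X j)) = C (c * d * z 0) * X 0"
        unfolding 1 shift_X
        by (simp only: if_True simp_thms \<psi>.mult \<psi>X \<psi>C C.mult assms(3)) (simp add: mult_ac)
      ultimately show ?thesis by (simp add: assms(2))
    next
      case 2
      have "shift J v (?\<theta> (shift J z (X j))) = C (z j) * X 0 + C t * (C (v j) * X 0 + X j)"
        using 2 assms(1,5) by (simp add: shift_X \<theta>.mult \<theta>.add \<theta>X \<theta>C S.mult S.add shift_C)
      also have "\<dots> = C (c * d * (z j + t * v j)) * X 0 + C t * X j"
        by (simp add: assms(2) C.add C.mult algebra_simps)
      also have "\<dots> = C (p j) * ?\<psi> (X 0) + ?\<psi> (X j)"
        unfolding \<psi>X assms(4)[OF 2(2)] using 2 by (simp add: C.mult mult_ac)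
      also have "\<dots> = ?\<psi> (shift J p (X j))"
        using 2 by (simp add: shift_X \<psi>.mult \<psi>.add \<psi>C)
      finally show ?thesis .
    next
      case 3
      then show ?thesis by (simp add: shift_X \<theta>X \<psi>X)
    qed
  qed
  moreover have "shift J v (?\<theta> (shift J z f)) = ev C (\<lambda>j. shift J v (?\<theta> (shift J z (X j)))) f"
    by (subst (1) ev_C_X[of f, symmetric], simp only: shift_ev ev_ev[OF rhom_C rhom_id])
  moreover have "?\<psi> (shift J p f) = ev C (\<lambda>j. ?\<psi> (shift J p (X j))) f"
    by (subst (1) ev_C_X[of f, symmetric], simp only: shift_ev ev_ev[OF rhom_C rhom_id])
  ultimately show ?thesis by simp
qed

text \<open>
  The points \<open>p = c (z + t v)\<close>, with \<open>c\<close> invertible, collide at \<open>z\<close> for \<open>t = 0\<close>, and their directions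
  \<open>v\<close> at \<open>t = 0\<close> run through the grid.
\<close>

lemma collision_order:
  fixes f :: "'a::idom poly mpol" and z :: "nat \<Rightarrow> 'a"
  assumes J: "finite J" "0 \<notin> J" and S: "finite S"
    and collide: "\<And>q. (\<And>j. j \<in> J \<Longrightarrow> q j \<in> S) \<Longrightarrow> \<exists>c d p v. c * d = 1 \<and> p 0 = c * [:z 0:] \<and>
      (\<forall>j\<in>J. p j = c * ([:z j:] + T * v j) \<and> poly (v j) 0 = q j) \<and> vanish J k p f"
  shows "vanish J (card S * k) z (mapc (\<lambda>p. poly p 0) f)"
proof -
  let ?e0 = "\<lambda>p. poly p (0::'a)"
  define f1 where "f1 = shift J (\<lambda>j. [:z j:]) f"
  have f1_0: "mapc ?e0 f1 = shift J z (mapc ?e0 f)"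
    unfolding f1_def by (subst mapc_shift[OF rhom_poly]) simp
  show ?thesis
  proof (cases "f1 = 0")
    case True
    then show ?thesis using f1_0 by (simp add: vanish_def mapc_def ev_def)
  next
    case False
    \<comment> \<open>This is the order in t of a coefficient of \<open>f1\<close> after the zoom
      x_j -> t x_j for \<open>j \<in> J\<close>; hence t^e is the lowest power of t that
      occurs.\<close>
    let ?o = "\<lambda>m. Polynomial.order 0 (lookup f1 m) + wt J m"
    have ne: "finite (?o ` keys f1)" "?o ` keys f1 \<noteq> {}"
      using False by simp_all
    define e where "e = Min (?o ` keys f1)"
    have e_le: "e \<le> ?o m" if "m \<in> keys f1" for m
      unfolding e_def using that ne by auto
    let ?\<theta> = "ev C (\<lambda>j. C (if j \<in> J then T else 1) * X j) :: 'a poly mpol \<Rightarrow> _"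
    have lookup_\<theta>: "lookup (?\<theta> g) m = T ^ wt J m * lookup g m" for g m
      using lookup_ev_scale[of "\<lambda>x. x" "\<lambda>j. if j \<in> J then T else 1" g m]
      unfolding mon_ev_wt[OF J(1)] by (simp only: mult.commute)
    have "T ^ e dvd lookup (?\<theta> f1) m" if "m \<in> keys (?\<theta> f1)" for m
    proof -
      have m: "m \<in> keys f1" using that by (auto simp: in_keys_iff lookup_\<theta>)
      then have "lookup f1 m \<noteq> 0" by (simp add: in_keys_iff)
      then show ?thesis
        unfolding T_power_dvd lookup_\<theta> using e_le[OF m] by (simp add: order_T_power_mult add.commute)
    qed
    then obtain G where G: "?\<theta> f1 = C (T ^ e) * G" by (rule C_mult_exists)
    have lookup_G: "T ^ e * lookup G m = T ^ wt J m * lookup f1 m" for m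
      using lookup_\<theta>[of f1 m] unfolding G lookup_C_mult .
    have G_0: "lookup f1 m \<noteq> 0 \<longleftrightarrow> lookup G m \<noteq> 0" for m
      using lookup_G[of m] by (metis mult_eq_0_iff pCons_eq_0_iff power_eq_0_iff zero_neq_one)
    have order_G: "e + Polynomial.order 0 (lookup G m) = ?o m" if "lookup G m \<noteq> 0" for m
      using arg_cong[OF lookup_G[of m], of "Polynomial.order 0"] that G_0[of m]
      by (simp add: order_T_power_mult add.commute)
    \<comment> \<open>The coefficient of t^e in the zoomed polynomial.\<close>
    define g where "g = mapc ?e0 G"
    have lookup_g: "lookup g m = poly (lookup G m) 0" for m
      unfolding g_def by (rule lookup_mapc) simp
    have g0: "g \<noteq> 0"
    proof -
      obtain m where m: "m \<in> keys f1" "?o m = e" using Min_in[OF ne] unfolding e_def by auto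
      then have "lookup G m \<noteq> 0" using G_0 by (simp add: in_keys_iff)
      then have "lookup g m \<noteq> 0"
        using order_G[of m] m(2) unfolding lookup_g by (simp flip: order_eq_0_iff_poly)
      then show ?thesis by (metis lookup_zero)
    qed
    \<comment> \<open>A monomial that survives at t = 0 attains the minimum \<open>e\<close>, and
      its weight is one of the two nonnegative summands of \<open>e\<close>.\<close>
    have wt_g: "wt J m \<le> e" if "m \<in> keys g" for m
    proof -
      have "poly (lookup G m) 0 \<noteq> 0" using that by (simp add: in_keys_iff lookup_g)
      then have "lookup G m \<noteq> 0" "Polynomial.order 0 (lookup G m) = 0" by (auto intro: order_0I)
      then show ?thesis using order_G[of m] by simp
    qed
    have "card S * k \<le> e"
    proof (rule grid_bound[OF J S g0 wt_g])
      fix q :: "nat \<Rightarrow> 'a" assume q: "q 0 = 1" "\<And>j. j \<in> J \<Longrightarrow> q j \<in> S"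
      obtain c d p v where *: "c * d = 1" "p 0 = c * [:z 0:]"
        "\<And>j. j \<in> J \<Longrightarrow> p j = c * ([:z j:] + T * v j)" "\<And>j. j \<in> J \<Longrightarrow> poly (v j) 0 = q j"
        "vanish J k p f"
        using collide[of q, OF q(2)] by blast
      \<comment> \<open>Only the directions in \<open>J\<close> are prescribed; the zeroth
        coordinate is normalized to match the grid points.\<close>
      let ?v = "v(0 := 1)"
      let ?\<psi> = "ev C (\<lambda>j. C (if j = 0 then d else if j \<in> J then T else 1) * X j) :: 'a poly mpol \<Rightarrow> _"
      have "shift J ?v (?\<theta> f1) = ?\<psi> (shift J p f)"
        unfolding f1_def by (rule rescaling_shift[OF J(2) *(1)]) (use * J(2) in auto)
      moreover have "keys (?\<psi> h) \<subseteq> keys h" for h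
        by (auto simp: in_keys_iff lookup_ev_scale[of "\<lambda>x. x"])
      ultimately have "vanish J k ?v (?\<theta> f1)" using *(5) unfolding vanish_def low_def by auto
      then have "vanish J k ?v G" unfolding G by (subst (asm) vanish_C_mult) auto
      from vanish_mapc[OF rhom_poly this]
      have "vanish J k (\<lambda>j. poly (?v j) 0) g" unfolding g_def .
      moreover have "poly (?v j) 0 = q j" if "j \<in> insert 0 J" for j using that q(1) *(4) J(2) by auto
      ultimately show "vanish J k q g" by (subst (asm) vanish_cong) auto
    qed blast+
    \<comment> \<open>Here the coefficient has order 0 in t, so the weight alone accounts for at
      least \<open>e\<close>.\<close>
    moreover have "e \<le> wt J m" if "m \<in> keys (mapc ?e0 f1)" for m
    proof -
      have "poly (lookup f1 m) 0 \<noteq> 0" using that by (simp add: in_keys_iff lookup_mapc)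
      then have "lookup f1 m \<noteq> 0" "Polynomial.order 0 (lookup f1 m) = 0" by (auto intro: order_0I)
      then show ?thesis using e_le[of m] by (simp add: in_keys_iff)
    qed
    ultimately show ?thesis unfolding vanish_def f1_0[symmetric] low_def by (meson order_trans)
  qed
qed

section \<open>Specialization of the generic points\<close>

lemma subrng_poly_coeffs:
  assumes "subrng P"
  shows "subrng {p. \<forall>n. poly.coeff p n \<in> P}"
  using assms unfolding subrng_def
proof (intro conjI ballI CollectI allI)
  fix p q :: "'a poly" and n
  assume p: "p \<in> {p. \<forall>n. poly.coeff p n \<in> P}" and q: "q \<in> {p. \<forall>n. poly.coeff p n \<in> P}"
  then show "poly.coeff (p * q) n \<in> P"
    unfolding coeff_mult by (intro subrng_sum[OF assms]) (use assms in \<open>auto simp: subrng_def\<close>)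
qed (auto simp: one_pCons coeff_pCons split: nat.splits)

text \<open>The collision is carried out on polynomials in the z_ij, where specializing is a ring
  homomorphism. The inclusion of the keys bounds the degree of the result and the variables in it,
  and the condition on the coefficients puts it over the field of \<open>b\<close> generic
  points.\<close>

lemma specialization_exists:
  fixes F :: "'k::alg_closed_field mpol mpol"
  assumes "F \<noteq> 0"
    and van: "\<And>I. I < b * s ^ N \<Longrightarrow> vanish {Suc 0..N} k (\<lambda>l. X (I * (N + 1) + l)) F"
  obtains G :: "'k mpol mpol"
  where "G \<noteq> 0" "keys G \<subseteq> keys F" "\<And>m. lookup G m \<in> carr UNIV {..<b * (N + 1)}"
    "\<And>i. i < b \<Longrightarrow> vanish {Suc 0..N} (s * k) (\<lambda>l. X (i * (N + 1) + l)) G"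
proof -
  let ?J = "{Suc 0..N}"
  define r where "r = s ^ N"
  define M where "M = b * r * (N + 1)"
  obtain m0 where m0: "lookup F m0 \<noteq> 0"
    using assms(1) by (metis lookup_zero poly_mapping_eqI)
  \<comment> \<open>The product of the variables forces the first \<open>M\<close> coordinates of
    \<zeta> to be nonzero, so that the rescaling factors \<open>c I\<close> are invertible.\<close>
  have "lookup F m0 * (\<Prod>n<M. X n) \<noteq> 0" using m0 by simp
  then obtain \<zeta> where \<zeta>: "ev (\<lambda>x. x) \<zeta> (lookup F m0 * (\<Prod>n<M. X n)) \<noteq> 0"
    using exists_nonvanishing_point[OF infinite_UNIV_alg_closed] by blast
  interpret E: rhom "ev (\<lambda>x. x) \<zeta>" by (intro rhom_ev rhom_id)
  have \<zeta>X: "\<zeta> n \<noteq> 0" if "n < M" for n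
    using \<zeta> that by (auto simp: E.mult E.prod ev_X)
  have \<zeta>F: "ev (\<lambda>x. x) \<zeta> (lookup F m0) \<noteq> 0" using \<zeta> by (auto simp: E.mult)
  obtain S :: "'k set" where S: "finite S" "card S = s"
    using infinite_arbitrarily_large[OF infinite_UNIV_alg_closed] by blast
  have grid: "finite (PiE ?J (\<lambda>_. S))" "card (PiE ?J (\<lambda>_. S)) = r"
    using S by (simp_all add: finite_PiE card_PiE r_def)
  obtain Q where Q: "bij_betw Q {0..<r} (PiE ?J (\<lambda>_. S))"
    using ex_bij_betw_nat_finite[OF grid(1)] unfolding grid(2) by blast
  define c where "c I = \<zeta> (I * (N + 1))" for I
  \<comment> \<open>Point \<open>I\<close> lies in cluster \<open>I div r\<close> at grid position
    \<open>I mod r\<close>. The direction is q at t = 0 and the normalized I-th point of \<zeta> at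
    t = 1, so w is the difference of these two.\<close>
  define v where "v I l = [:C (Q (I mod r) l), C (\<zeta> (I * (N + 1) + l) / c I - Q (I mod r) l) :: 'k mpol:]" for I l
  define pt where "pt I l = [:C (c I):] * (if l = 0 then [:X (I div r * (N + 1)):]
      else [:X (I div r * (N + 1) + l):] + T * v I l)" for I l
  \<comment> \<open>Indeterminates beyond those of the \<open>b * r\<close> points become the
    constants of \<zeta>, so that they disappear from the coefficients.\<close>
  define \<sigma> where "\<sigma> n = (if n < M then pt (n div (N + 1)) (n mod (N + 1)) else [:C (\<zeta> n):])" for n
  define \<phi> where "\<phi> = ev (\<lambda>a. [:C a:]) \<sigma>"
  interpret \<phi>: rhom \<phi>
    unfolding \<phi>_def by (intro rhom_ev rhom_comp[OF rhom_const_poly rhom_C])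
  have \<phi>X: "\<phi> (X n) = \<sigma> n" for n
    unfolding \<phi>_def by (rule ev_X) (simp_all add: one_pCons)
  have lt: "I * (N + 1) + l < M" if "I < b * r" "l \<le> N" for I l
  proof -
    have "I * (N + 1) + l < (I + 1) * (N + 1)" using that by simp
    also have "\<dots> \<le> b * r * (N + 1)" using that by (intro mult_right_mono) auto
    finally show ?thesis by (simp add: M_def)
  qed
  have \<sigma>: "\<sigma> (I * (N + 1) + l) = pt I l" if "I < b * r" "l \<le> N" for I l
    using lt[OF that] that(2) by (simp add: \<sigma>_def del: mult_Suc_right)
  have nz: "\<phi> (lookup F m0) \<noteq> 0"
  proof -
    \<comment> \<open>For \<open>t = 1\<close> and all \<open>z\<^sub>i = (1, 0, \<dots>, 0)\<close> the specialized points become the point \<open>\<zeta>\<close>.\<close>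
    define \<rho> where "\<rho> n = (if n mod (N + 1) = 0 then 1 else 0 :: 'k)" for n
    define \<epsilon> where "\<epsilon> p = ev (\<lambda>x. x) \<rho> (poly p 1)" for p :: "'k mpol poly"
    interpret \<epsilon>: rhom \<epsilon>
      unfolding \<epsilon>_def by (rule rhom_comp[OF rhom_ev[OF rhom_id] rhom_poly])
    interpret \<rho>: rhom "ev (\<lambda>x. x) \<rho>" by (intro rhom_ev rhom_id)
    have "\<epsilon> (\<sigma> n) = \<zeta> n" for n
    proof (cases "n < M")
      case True
      define I l where "I = n div (N + 1)" and "l = n mod (N + 1)"
      have n: "n = I * (N + 1) + l" unfolding I_def l_def by (rule div_mult_mod_eq[symmetric])
      have l: "l \<le> N" using mod_less_divisor[of "N + 1" n] unfolding l_def by linarith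
      have "\<sigma> n = pt I l" using True by (simp add: \<sigma>_def I_def l_def)
      moreover have "I * (N + 1) < M" using True n by linarith
      then have "c I \<noteq> 0" unfolding c_def by (rule \<zeta>X)
      moreover have "\<rho> (i * (N + 1)) = 1" "l \<noteq> 0 \<Longrightarrow> \<rho> (i * (N + 1) + l) = 0" for i
        using l by (simp_all add: \<rho>_def del: mult_Suc_right)
      ultimately show ?thesis
        by (cases "l = 0") (simp_all add: pt_def v_def \<epsilon>_def \<rho>.add \<rho>.mult \<rho>.diff ev_X ev_C n c_def left_diff_distrib
          del: mult_Suc_right)
    qed (simp add: \<sigma>_def \<epsilon>_def ev_C)
    then have "\<epsilon> (\<phi> p) = ev (\<lambda>x. x) \<zeta> p" for p
      unfolding \<phi>_def rhom_ev_comp[OF \<epsilon>.rhom_axioms] by (simp add: \<epsilon>_def ev_C)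
    then show ?thesis using \<zeta>F \<epsilon>.zero by metis
  qed
  then have "lookup (mapc \<phi> F) m0 \<noteq> 0" by (simp add: lookup_mapc \<phi>.zero)
  then have "mapc \<phi> F \<noteq> 0" by (metis lookup_zero)
  then obtain e F1 where F1: "mapc \<phi> F = C (T ^ e) * F1" "mapc (\<lambda>p. poly p 0) F1 \<noteq> 0"
    by (rule leading_coefficient_exists)
  define G where "G = mapc (\<lambda>p. poly p 0) F1"
  have lookup_F1: "\<phi> (lookup F m) = T ^ e * lookup F1 m" for m
    using arg_cong[OF F1(1), of "\<lambda>g. lookup g m"] by (simp add: lookup_mapc \<phi>.zero lookup_C_mult)
  have lookup_G: "lookup G m = poly (lookup F1 m) 0" for m
    unfolding G_def by (rule lookup_mapc) simp
  have T_power: "T ^ n = (monom 1 n :: 'k mpol poly)" for n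
    by (induction n) (simp_all add: monom_Suc monom_0 one_pCons)
  show ?thesis
  proof (rule that)
    show "G \<noteq> 0" using F1(2) by (simp add: G_def)
    show "keys G \<subseteq> keys F"
    proof
      fix m assume "m \<in> keys G"
      then have "lookup F1 m \<noteq> 0" by (auto simp: in_keys_iff lookup_G)
      then have "\<phi> (lookup F m) \<noteq> 0" unfolding lookup_F1 by simp
      then show "m \<in> keys F" by (auto simp: in_keys_iff \<phi>.zero)
    qed
    \<comment> \<open>The polynomials in t over the ring in the indeterminates of \<open>b\<close>
      points form a subring that contains all \<open>\<sigma> n\<close>. A coefficient of
      \<open>G\<close> is the coefficient at t^e of an element of it.\<close>
    show "lookup G m \<in> carr UNIV {..<b * (N + 1)}" for m
    proof -
      let ?P = "carr UNIV {..<b * (N + 1)} :: 'k mpol set"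
      let ?P' = "{p. \<forall>n. poly.coeff p n \<in> ?P}"
      have P: "subrng ?P" by (intro subrng_carr subrng_UNIV)
      have P': "subrng ?P'" by (rule subrng_poly_coeffs[OF P])
      have const: "[:a:] \<in> ?P'" if "a \<in> ?P" for a
        using that P by (auto simp: coeff_pCons subrng_def split: nat.splits)
      have CP: "C a \<in> ?P" for a by (rule C_carr) simp_all
      have TP: "T \<in> ?P'" using P by (auto simp: coeff_pCons subrng_def split: nat.splits)
      have vP: "v I l \<in> ?P'" for I l
        unfolding v_def using P CP by (auto simp: coeff_pCons subrng_def split: nat.splits)
      have "\<sigma> n \<in> ?P'" for n
      proof (cases "n < M")
        case True
        then have "n div (N + 1) < b * r" unfolding M_def by (rule less_mult_imp_div_less)
        then have "n div (N + 1) div r < b" by (rule less_mult_imp_div_less)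
        then have *: "n div (N + 1) div r * (N + 1) + l < b * (N + 1)" if "l \<le> N" for l
        proof -
          have "n div (N + 1) div r * (N + 1) + l < (n div (N + 1) div r + 1) * (N + 1)"
            using that by simp
          also have "\<dots> \<le> b * (N + 1)"
            using \<open>n div (N + 1) div r < b\<close> by (intro mult_right_mono) auto
          finally show ?thesis .
        qed
        have l: "n mod (N + 1) \<le> N" using mod_less_divisor[of "N + 1" n] by linarith
        have X0: "[:X (n div (N + 1) div r * (N + 1)):] \<in> ?P'"
          using *[of 0] by (intro const X_carr subrng_UNIV) simp
        have Xl: "[:X (n div (N + 1) div r * (N + 1) + n mod (N + 1)):] \<in> ?P'"
          using *[OF l] by (intro const X_carr subrng_UNIV) simp
        have closed: "x + y \<in> ?P'" "x * y \<in> ?P'" if "x \<in> ?P'" "y \<in> ?P'" for x y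
          using P' that unfolding subrng_def by blast+
        have "pt (n div (N + 1)) (n mod (N + 1)) \<in> ?P'"
          unfolding pt_def
          by (rule closed(2)[OF const[OF CP]], split if_split)
            (intro conjI impI X0 closed(1)[OF Xl] closed(2)[OF TP vP])
        then show ?thesis using True by (simp only: \<sigma>_def if_True)
      next
        case False
        then show ?thesis using const[OF CP] by (simp only: \<sigma>_def if_False)
      qed
      then have "\<phi> (lookup F m) \<in> ?P'"
        unfolding \<phi>_def by (intro subrng_ev[OF P'] const CP)
      then have "poly.coeff (T ^ e * lookup F1 m) e \<in> ?P" unfolding lookup_F1 by blast
      then show ?thesis by (simp add: T_power coeff_monom_mult lookup_G poly_0_coeff_0)
    qed
    fix i assume i: "i < b"
    have "card (C ` S) = s" using S inj_C by (metis card_image inj_on_subset subset_UNIV)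
    moreover have "vanish ?J (card (C ` S) * k) (\<lambda>l. X (i * (N + 1) + l)) G"
      unfolding G_def
    proof (rule collision_order)
      fix q :: "nat \<Rightarrow> 'k mpol" assume q: "\<And>j. j \<in> ?J \<Longrightarrow> q j \<in> C ` S"
      \<comment> \<open>The grid of the collision consists of constant polynomials;
        \<open>q'\<close> pulls the direction back to \<open>S\<close>, restricted so that it lies
        in the extensional product enumerated by \<open>Q\<close>.\<close>
      define q' where "q' = restrict (\<lambda>l. inv_into UNIV C (q l)) ?J"
      have Cq': "C (q' l) = q l \<and> q' l \<in> S" if "l \<in> ?J" for l
        using q[OF that] that by (auto simp: q'_def inv_f_f[OF inj_C])
      then have "q' \<in> PiE ?J (\<lambda>_. S)" by (auto simp: q'_def)
      then obtain j where j: "j < r" "Q j = q'"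
        using Q unfolding bij_betw_def by (metis atLeastLessThan_iff imageE)
      \<comment> \<open>The point of cluster \<open>i\<close> whose limiting direction is
        \<open>q\<close>.\<close>
      define I where "I = i * r + j"
      have I: "I < b * r" "I div r = i" "I mod r = j"
      proof -
        have "I < (i + 1) * r" using j by (simp add: I_def)
        also have "\<dots> \<le> b * r" using i by (intro mult_right_mono) auto
        finally show "I < b * r" .
      qed (use j in \<open>simp_all add: I_def\<close>)
      have "vanish ?J k (\<lambda>l. X (I * (N + 1) + l)) F" using van I(1) by (simp add: r_def)
      from vanish_mapc[OF \<phi>.rhom_axioms this]
      have "vanish ?J k (\<lambda>l. \<sigma> (I * (N + 1) + l)) F1"
        unfolding F1(1) \<phi>X by (subst (asm) vanish_C_mult) auto
      then have van1: "vanish ?J k (pt I) F1"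
      proof (subst vanish_cong)
        fix l assume "l \<in> insert 0 ?J"
        then have "l \<le> N" by auto
        then show "pt I l = \<sigma> (I * (N + 1) + l)" by (rule \<sigma>[OF I(1), symmetric])
      qed
      have "I * (N + 1) < M" using lt[OF I(1), of 0] by simp
      then have "c I \<noteq> 0" unfolding c_def by (rule \<zeta>X)
      then have "C (c I) * C (inverse (c I)) = 1" by (simp flip: rhom.mult[OF rhom_C])
      then have unit: "[:C (c I):] * [:C (inverse (c I)):] = 1" by (simp add: one_pCons mult.commute)
      show "\<exists>c d p v. c * d = 1 \<and> p 0 = c * [:X (i * (N + 1) + 0):] \<and>
          (\<forall>l\<in>?J. p l = c * ([:X (i * (N + 1) + l):] + T * v l) \<and> poly (v l) 0 = q l) \<and>
          vanish ?J k p F1"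
      proof (intro exI conjI ballI)
        show "[:C (c I):] * [:C (inverse (c I)):] = 1" by (rule unit)
        show "vanish ?J k (pt I) F1" by (rule van1)
        show "pt I 0 = [:C (c I):] * [:X (i * (N + 1) + 0):]"
          unfolding pt_def I by simp
        fix l assume l: "l \<in> ?J"
        then show "pt I l = [:C (c I):] * ([:X (i * (N + 1) + l):] + T * v I l)"
          unfolding pt_def I by simp
        show "poly (v I l) 0 = q l"
          unfolding v_def I j using Cq'[OF l] by simp
      qed
    qed (use S in auto)
    ultimately show "vanish ?J (s * k) (\<lambda>l. X (i * (N + 1) + l)) G" by simp
  qed
qed

section \<open>The field of definition of the generic points\<close>

lemma rhom_Fract: "rhom (\<lambda>p. Fract p 1)"
  by standard (simp_all add: One_fract_def)

lemma inj_Fract: "inj (\<lambda>p. Fract p 1)"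
  by (rule injI) (simp add: eq_fract)

lemma common_denominator:
  fixes A :: "'a::idom fract set"
  assumes "finite A"
  shows "\<exists>D. D \<noteq> 0 \<and> (\<forall>x\<in>A. \<exists>p. Fract D 1 * x = Fract p 1)"
  using assms
proof induction
  case empty
  show ?case by (intro exI[of _ 1]) simp
next
  case (insert x A)
  then obtain D where D: "D \<noteq> 0" "\<And>y. y \<in> A \<Longrightarrow> \<exists>p. Fract D 1 * y = Fract p 1" by blast
  obtain u w where x: "x = Fract u w" "w \<noteq> 0" by (cases x)
  have "Fract (D * w) 1 * x = Fract (D * u) 1"
    using x(2) unfolding x(1) by (simp add: eq_fract)
  moreover have "\<exists>p. Fract (D * w) 1 * y = Fract p 1" if y: "y \<in> A" for y
  proof -
    obtain p where p: "Fract D 1 * y = Fract p 1" using D(2)[OF y] by blast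
    have "Fract (D * w) 1 = Fract w 1 * Fract D 1" by (simp add: mult.commute)
    then have "Fract (D * w) 1 * y = Fract w 1 * (Fract D 1 * y)" by (simp only: mult.assoc)
    also have "\<dots> = Fract (w * p) 1" unfolding p by simp
    finally show ?thesis by blast
  qed
  moreover have "D * w \<noteq> 0" using D(1) x(2) by simp
  ultimately show ?case by (metis insert_iff)
qed

text \<open>A specialization may send a denominator to zero, so forms over the rational function
  field are first made polynomial in the z_ij.\<close>

lemma clear_denominators:
  fixes f :: "'a::idom fract mpol"
  obtains D F where "D \<noteq> 0" "mapc (\<lambda>p. Fract p 1) F = C (Fract D 1) * f"
proof -
  obtain D where D: "D \<noteq> 0" "\<forall>x\<in>lookup f ` keys f. \<exists>p. Fract D 1 * x = Fract p 1"
    using common_denominator[OF finite_imageI[OF finite_keys]] by blast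
  have "\<forall>m\<in>keys f. \<exists>p. Fract D 1 * lookup f m = Fract p 1"
    using D(2) by (simp only: ball_simps)
  then obtain n where n: "\<forall>m\<in>keys f. Fract D 1 * lookup f m = Fract (n m) 1"
    by (rule bchoice[THEN exE])
  let ?F = "\<Sum>m\<in>keys f. Poly_Mapping.single m (n m)"
  have F: "lookup ?F m = (if m \<in> keys f then n m else 0)" for m
    by (auto simp: lookup_sum lookup_single when_def sum.delta)
  have "mapc (\<lambda>p. Fract p 1) ?F = C (Fract D 1) * f"
  proof (rule poly_mapping_eqI)
    fix m
    have "lookup (mapc (\<lambda>p. Fract p 1) ?F) m = Fract (lookup ?F m) 1"
      by (rule lookup_mapc) (rule rhom.zero[OF rhom_Fract])
    also have "\<dots> = Fract D 1 * lookup f m"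
    proof (cases "m \<in> keys f")
      case True
      then show ?thesis unfolding F using n by (simp only: if_True)
    next
      case False
      then have "lookup f m = 0" by (simp add: in_keys_iff)
      then show ?thesis unfolding F using False by (simp add: Zero_fract_def)
    qed
    finally show "lookup (mapc (\<lambda>p. Fract p 1) ?F) m = lookup (C (Fract D 1) * f) m"
      by (simp only: lookup_C_mult)
  qed
  then show ?thesis using that D(1) by blast
qed

lemma generic_field_alt:
  "generic_field N s = {Fract p q | p q. q \<noteq> 0 \<and> p \<in> carr UNIV {..<s * (N + 1)} \<and> q \<in> carr UNIV {..<s * (N + 1)}}"
  unfolding generic_field_def carr_def
  by (rule Collect_cong) (simp only: Ball_def Un_iff in_keys_iff mem_Collect_eq UNIV_I, blast)

lemma projective_generic_field: "projective (generic_field N s :: 'k::field ratfun set)"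
proof
  let ?P = "carr UNIV {..<s * (N + 1)} :: 'k mpol set"
  let ?F = "generic_field N s :: 'k ratfun set"
  have P: "0 \<in> ?P" "1 \<in> ?P" "\<And>x. x \<in> ?P \<Longrightarrow> - x \<in> ?P"
    "\<And>x y. x \<in> ?P \<Longrightarrow> y \<in> ?P \<Longrightarrow> x + y \<in> ?P" "\<And>x y. x \<in> ?P \<Longrightarrow> y \<in> ?P \<Longrightarrow> x * y \<in> ?P"
    using subrng_carr[OF subrng_UNIV, of "{..<s * (N + 1)}"] unfolding subrng_def by blast+
  have F: "Fract p q \<in> ?F" if "q \<noteq> 0" "p \<in> ?P" "q \<in> ?P" for p q
    unfolding generic_field_alt using that by blast
  have E: "\<exists>p q. x = Fract p q \<and> q \<noteq> 0 \<and> p \<in> ?P \<and> q \<in> ?P" if "x \<in> ?F" for x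
    using that unfolding generic_field_alt by blast
  show "subrng ?F"
    unfolding subrng_def
  proof (intro conjI ballI)
    show "0 \<in> ?F" "1 \<in> ?F" unfolding Zero_fract_def One_fract_def using F P by simp_all
    fix x assume "x \<in> ?F"
    then obtain p q where x: "x = Fract p q" "q \<noteq> 0" "p \<in> ?P" "q \<in> ?P" using E by blast
    then show "- x \<in> ?F" using F P by simp
    fix y assume "y \<in> ?F"
    then obtain p' q' where y: "y = Fract p' q'" "q' \<noteq> 0" "p' \<in> ?P" "q' \<in> ?P" using E by blast
    show "x + y \<in> ?F" "x * y \<in> ?F" using x y F P by simp_all
  qed
  show "inverse x \<in> ?F" if x: "x \<in> ?F" for x
  proof -
    obtain p q where x: "x = Fract p q" "q \<noteq> 0" "p \<in> ?P" "q \<in> ?P" using E[OF x] by blast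
    show ?thesis
    proof (cases "p = 0")
      case True
      then have "inverse x = Fract 0 1" unfolding x(1) by (simp add: eq_fract)
      then show ?thesis using F P by simp
    qed (use x F in simp)
  qed
qed

lemma generic_point_alt: "generic_point N i = (\<lambda>j. Fract (X (i * (N + 1) + j)) 1)"
  by (rule ext) (simp add: generic_point_def X_def)

lemma Fract_mem_generic_field:
  fixes p :: "'k::field mpol"
  shows "p \<in> carr UNIV {..<s * (N + 1)} \<Longrightarrow> Fract p 1 \<in> generic_field N s"
  unfolding generic_field_alt
  by (rule CollectI, rule exI[of _ p], rule exI[of _ 1])
    (use subrng_carr[where 'a = 'k, OF subrng_UNIV, of "{..<s * (N + 1)}"] in \<open>simp add: subrng_def\<close>)

lemma generic_point_mem:
  assumes "i < s" "j \<le> N" shows "generic_point N i j \<in> generic_field N s"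
proof -
  have "i * (N + 1) + j < (i + 1) * (N + 1)" using assms by simp
  also have "\<dots> \<le> s * (N + 1)" using assms by (intro mult_right_mono) auto
  finally show ?thesis
    unfolding generic_point_alt by (intro Fract_mem_generic_field X_carr subrng_UNIV) simp
qed

lemma generic_point_nonzero: "generic_point N i j \<noteq> 0"
  unfolding generic_point_alt Zero_fract_def by (simp add: eq_fract del: fract_collapse)

abbreviation generic_symbolic_power :: "nat \<Rightarrow> nat \<Rightarrow> nat \<Rightarrow> 'k::field ratfun mpol set" where
  "generic_symbolic_power N s m \<equiv> symbolic_power (generic_field N s) N s (generic_point N) m"

text \<open>Translate membership in the ideal powers into orders of vanishing, clear denominators,
  let the points collide, and embed the result into the rational functions of \<open>b\<close>
  points. The zeroth coordinate of a generic point is nonzero, which allows the translation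
  back.\<close>

lemma symbolic_power_specialize:
  fixes f :: "'k::alg_closed_field ratfun mpol"
  assumes "b > 0" "s > 0" and f: "f \<in> generic_symbolic_power N (b * s ^ N) m" "f \<noteq> 0"
  obtains g :: "'k ratfun mpol" where "g \<in> generic_symbolic_power N b (s * m)" "g \<noteq> 0"
    "total_degree g \<le> total_degree f"
proof -
  let ?\<iota> = "\<lambda>p :: 'k mpol. Fract p 1"
  let ?J = "{Suc 0..N}"
  interpret R1: projective "generic_field N (b * s ^ N) :: 'k ratfun set" N
    by (rule projective_generic_field)
  interpret R2: projective "generic_field N b :: 'k ratfun set" N
    by (rule projective_generic_field)
  obtain D F where D: "D \<noteq> 0" "mapc ?\<iota> F = C (Fract D 1) * f"
    by (rule clear_denominators)
  have D1: "Fract D 1 \<noteq> 0" using D(1) by (simp add: Zero_fract_def eq_fract del: fract_collapse)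
  have keys_F: "keys F = keys f"
  proof -
    have "lookup (mapc ?\<iota> F) m = ?\<iota> (lookup F m)" for m
      by (rule lookup_mapc) (simp add: Zero_fract_def)
    moreover have "?\<iota> p = 0 \<longleftrightarrow> p = 0" for p
      by (simp add: Zero_fract_def eq_fract del: fract_collapse)
    ultimately have "keys (mapc ?\<iota> F) = keys F" by (simp add: set_eq_iff in_keys_iff)
    then show ?thesis unfolding D(2) keys_C_mult[OF D1] by simp
  qed
  have f_pow: "f \<in> R1.pow_ideal (generic_point N I) m" if "I < b * s ^ N" for I
    using f(1) that by (simp add: symbolic_power_def)
  have van: "vanish ?J m (\<lambda>l. X (I * (N + 1) + l)) F" if "I < b * s ^ N" for I
  proof -
    have "vanish ?J m (generic_point N I) (mapc ?\<iota> F)"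
      unfolding D(2) vanish_C_mult[OF D1] by (rule R1.pow_ideal_vanish[OF f_pow[OF that]])
    then show ?thesis unfolding generic_point_alt by (rule vanish_mapc_inj[OF rhom_Fract inj_Fract])
  qed
  have F0: "F \<noteq> 0" using keys_F f(2) by (metis keys_eq_empty)
  obtain G :: "'k mpol mpol" where G: "G \<noteq> 0" "keys G \<subseteq> keys F"
    "\<And>m. lookup G m \<in> carr UNIV {..<b * (N + 1)}"
    "\<And>i. i < b \<Longrightarrow> vanish ?J (s * m) (\<lambda>l. X (i * (N + 1) + l)) G"
    by (rule specialization_exists[of F b s N m, OF F0 van]) (assumption, rule that)
  define g where "g = mapc ?\<iota> G"
  have lookup_g: "lookup g m = ?\<iota> (lookup G m)" for m
    unfolding g_def by (rule lookup_mapc) (simp add: Zero_fract_def)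
  have "keys g = keys G"
    by (simp add: set_eq_iff in_keys_iff lookup_g) (simp add: Zero_fract_def eq_fract del: fract_collapse)
  then have keys_g: "keys g \<subseteq> keys f" "keys g \<noteq> {}" using G(1,2) keys_F by auto
  \<comment> \<open>An intersection over no points would not confine \<open>f\<close> to the
    coordinate ring, so one point is needed here.\<close>
  have "0 < b * s ^ N" using assms(1,2) by simp
  then have "f \<in> carrier R1.R" using R1.pow_ideal_carr[OF f_pow] by blast
  then have g_carr: "g \<in> carrier R2.R"
    unfolding R1.carrier_R R2.carrier_R
    using keys_g(1) Fract_mem_generic_field[OF G(3)]
    by (auto simp: carr_def lookup_g[symmetric] subset_iff in_keys_iff)
  show ?thesis
  proof (rule that)
    show "g \<noteq> 0" using keys_g(2) by auto
    show "total_degree g \<le> total_degree f"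
      unfolding total_degree_def using keys_g by (intro Max_mono) auto
    have "g \<in> R2.pow_ideal (generic_point N i) (s * m)" if i: "i < b" for i
    proof (rule R2.vanish_pow_ideal[OF g_carr])
      show "generic_point N i j \<in> generic_field N b" if "j \<le> N" for j :: nat
        using generic_point_mem[OF i that] .
      show "generic_point N i 0 \<noteq> (0 :: 'k ratfun)" by (rule generic_point_nonzero)
      show "vanish ?J (s * m) (generic_point N i) g"
        unfolding g_def generic_point_alt by (rule vanish_mapc[OF rhom_Fract G(4)[OF i]])
    qed
    then show "g \<in> generic_symbolic_power N b (s * m)" by (simp add: symbolic_power_def)
  qed
qed

section \<open>The Waldschmidt constant\<close>

text \<open>Fekete's lemma, with the infimum as limit: write n = q k + r with k nearly optimal, and
  the contribution of the bounded remainder vanishes after division by n.\<close>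

lemma subadditive_convergent:
  fixes a :: "nat \<Rightarrow> real"
  assumes nonneg: "\<And>n. 0 \<le> a n" and sub: "\<And>m n. a (m + n) \<le> a m + a n"
  shows "convergent (\<lambda>n. a n / real n)"
proof -
  define L where "L = (INF n\<in>{1..}. a n / real n)"
  have bdd: "bdd_below ((\<lambda>n. a n / real n) ` {1..})"
    by (rule bdd_belowI2[of _ 0]) (simp add: nonneg)
  have lower: "L \<le> a n / real n" if "n \<ge> 1" for n
    unfolding L_def by (rule cINF_lower[OF bdd]) (use that in simp)
  have mult: "a (q * k + r) \<le> real q * a k + a r" for q k r
  proof (induction q)
    case (Suc q)
    have "a (Suc q * k + r) \<le> a k + a (q * k + r)" using sub[of k "q * k + r"] by (simp add: add_ac)
    then show ?case using Suc by (simp add: algebra_simps)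
  qed simp
  have "(\<lambda>n. a n / real n) \<longlonglongrightarrow> L"
  proof (rule LIMSEQ_I)
    fix e :: real assume e: "e > 0"
    have "\<exists>k\<in>{1..}. a k / real k < L + e / 2"
      using cINF_less_iff[OF _ bdd, of "L + e / 2"] e unfolding L_def by simp
    then obtain k where k: "k \<ge> 1" "a k / real k < L + e / 2" by auto
    \<comment> \<open>A common bound for all remainders modulo \<open>k\<close>; as the terms are
      nonnegative, the sum dominates each of them.\<close>
    define B where "B = (\<Sum>r<k. a r)"
    have B: "a r \<le> B" if "r < k" for r
      unfolding B_def using that nonneg by (intro member_le_sum) auto
    obtain n0 where n0: "2 * B / e < real n0" using reals_Archimedean2 by blast
    show "\<exists>no. \<forall>n\<ge>no. norm (a n / real n - L) < e"
    proof (intro exI allI impI)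
      fix n assume n: "n \<ge> max 1 n0"
      then have n1: "real n > 0" by simp
      have "2 * B / e < real n" using n n0 by linarith
      then have Bn: "B < real n * (e / 2)" using e by (simp add: field_simps)
      have "real (n div k) * a k = real (n div k * k) * (a k / real k)" using k(1) by simp
      also have "\<dots> \<le> real n * (a k / real k)"
        using nonneg[of k] by (intro mult_right_mono) (simp_all only: of_nat_le_iff div_times_less_eq_dividend, simp)
      also have "\<dots> \<le> real n * (L + e / 2)" using k(2) n1 by (intro mult_left_mono) auto
      finally have "real (n div k) * a k \<le> real n * (L + e / 2)" .
      moreover have "a n \<le> real (n div k) * a k + B"
        using mult[of "n div k" k "n mod k"] B[of "n mod k"] k(1) by simp
      ultimately have "a n < real n * (L + e)" using Bn by (simp add: algebra_simps)
      then have "a n / real n < L + e" using n1 by (simp add: pos_divide_less_eq mult.commute)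
      moreover have "L \<le> a n / real n" using n by (intro lower) simp
      ultimately show "norm (a n / real n - L) < e" by simp
    qed
  qed
  then show ?thesis by (rule convergentI)
qed

section \<open>Degrees of products and the least degree in an ideal\<close>

lemma mon_degree_add: "mon_degree (m + n) = mon_degree m + mon_degree n"
proof -
  have *: "mon_degree m = (\<Sum>j\<in>A. lookup m j)" if "finite A" "keys m \<subseteq> A" for A and m :: mon
    unfolding mon_degree_def by (rule sum.mono_neutral_left) (use that in \<open>auto simp: in_keys_iff\<close>)
  have "mon_degree (m + n) = (\<Sum>j\<in>keys m \<union> keys n. lookup (m + n) j)"
    by (rule *) (simp_all add: keys_add)
  also have "\<dots> = mon_degree m + mon_degree n"
    using *[of "keys m \<union> keys n" m] *[of "keys m \<union> keys n" n] by (simp add: lookup_add sum.distrib)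
  finally show ?thesis .
qed

lemma total_degree_mult_le:
  fixes f g :: "'a::idom mpol"
  assumes "f \<noteq> 0" "g \<noteq> 0"
  shows "total_degree (f * g) \<le> total_degree f + total_degree g"
  unfolding total_degree_def[of "f * g"]
proof (rule Max.boundedI)
  have "keys (f * g) \<noteq> {}" using assms by simp
  then show "mon_degree ` keys (f * g) \<noteq> {}" by simp
  fix d assume "d \<in> mon_degree ` keys (f * g)"
  then obtain m n where "m \<in> keys f" "n \<in> keys g" "d = mon_degree (m + n)"
    using keys_mult[of f g] by blast
  moreover have "mon_degree m \<le> total_degree f" if "m \<in> keys f" for m and f :: "'a mpol"
    unfolding total_degree_def using that by (intro Max_ge) auto
  ultimately show "d \<le> total_degree f + total_degree g"
    by (simp add: mon_degree_add add_mono)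
qed simp

lemma alpha_le: "f \<in> I \<Longrightarrow> f \<noteq> 0 \<Longrightarrow> alpha I \<le> total_degree f"
  unfolding alpha_def by (rule Least_le) blast

lemma alpha_attained:
  assumes "f \<in> I" "f \<noteq> 0"
  obtains g where "g \<in> I" "g \<noteq> 0" "total_degree g = alpha I"
proof -
  have "\<exists>g\<in>I. g \<noteq> 0 \<and> total_degree g = alpha I"
    unfolding alpha_def by (rule LeastI[of _ "total_degree f"]) (use assms in blast)
  then show ?thesis using that by blast
qed

text \<open>Choose a linear form through each point and multiply their \<open>m\<close>-th powers.
  Without a nonzero element the \<open>LEAST\<close> in \<open>alpha\<close> would have no
  meaning.\<close>

lemma generic_symbolic_power_nonzero:
  assumes "N \<ge> 1"
  shows "\<exists>f \<in> generic_symbolic_power N s m :: 'k::field ratfun mpol set. f \<noteq> 0"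
proof -
  interpret projective "generic_field N s :: 'k ratfun set" N
    by (rule projective_generic_field)
  define P where "P = (generic_point N :: nat \<Rightarrow> nat \<Rightarrow> 'k ratfun)"
  \<comment> \<open>The linear form z_i0 x_1 - z_i1 x_0, which vanishes at the i-th point.\<close>
  define g where "g i = C (P i 0) * X 1 + C (- P i 1) * X 0" for i
  have XR: "X j \<in> carrier R" if "j \<le> N" for j
    using that X_carr[OF _ F] by (auto simp: carrier_R)
  have CR: "C a \<in> carrier R" if "a \<in> generic_field N s" for a
    unfolding carrier_R using that F by (intro C_carr) (simp_all add: subrng_def)
  have PF: "P i j \<in> generic_field N s" if "i < s" "j \<le> N" for i j
    unfolding P_def using that by (rule generic_point_mem)
  have P0: "P i j \<noteq> 0" for i j unfolding P_def by (rule generic_point_nonzero)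
  have g_R: "g i \<in> carrier R" if "i < s" for i
  proof -
    have "- P i 1 \<in> generic_field N s" using PF[OF that, of 1] assms F by (simp add: subrng_def)
    then show ?thesis
      unfolding g_def using assms PF[OF that, of 0] by (intro R_closed CR XR) auto
  qed
  have g_pow: "g i \<in> pow_ideal (P i) 1" if i: "i < s" for i
  proof (rule vanish_pow_ideal[OF g_R[OF i] PF[OF i] P0])
    interpret S: rhom "shift J (P i)" by (rule rhom_shift)
    have "shift J (P i) (g i) = C (P i 0) * X 1 + (C (P i 1) + C (- P i 1)) * (C (P i 0) * X 0)"
      unfolding g_def S.add S.mult shift_C shift_X using assms by (simp add: algebra_simps)
    also have "\<dots> = Poly_Mapping.single (Poly_Mapping.single 1 1) (P i 0)"
      unfolding rhom.add[OF rhom_C, symmetric] by (simp add: C_def X_def mult_single)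
    finally have "keys (shift J (P i) (g i)) = {Poly_Mapping.single 1 1}" using P0 by simp
    then show "vanish J 1 (P i) (g i)"
      unfolding vanish_def low_def wt_def using assms by (simp add: lookup_single when_def)
  qed
  have g0: "g i \<noteq> 0" for i
  proof -
    have "Poly_Mapping.single (0 :: nat) (1 :: nat) \<noteq> Poly_Mapping.single 1 1"
      by (metis lookup_single_eq lookup_single_not_eq zero_neq_one)
    then have "lookup (g i) (Poly_Mapping.single 1 1) = P i 0"
      by (simp add: g_def C_def X_def mult_single lookup_add lookup_single when_def)
    then show ?thesis using P0 by (metis lookup_zero)
  qed
  have "(\<Prod>i<s. g i ^ m) \<in> generic_symbolic_power N s m"
    unfolding symbolic_power_def
  proof (intro INT_I)
    fix i assume i: "i \<in> {..<s}"
    have "(\<Prod>i<s. g i ^ m) = (\<Prod>i\<in>{..<s} - {i}. g i ^ m) * g i ^ m"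
      using i by (simp add: prod.remove mult.commute)
    moreover have "g i ^ m \<in> pow_ideal (P i) m"
      using pow_ideal_power[OF g_pow, of i m] i by simp
    moreover have "(\<Prod>i\<in>{..<s} - {i}. g i ^ m) \<in> carrier R"
      by (intro subrng_prod subrng_power subrng_R g_R) auto
    ultimately show "(\<Prod>i<s. g i ^ m) \<in> pow_ideal (generic_point N i) m"
      unfolding P_def[symmetric] by (simp add: pow_ideal_lmult)
  qed
  moreover have "(\<Prod>i<s. g i ^ m) \<noteq> 0" using g0 by simp
  ultimately show ?thesis by blast
qed

text \<open>Multiplying elements of least degree shows that \<open>alpha\<close> is subadditive
  along the symbolic powers. The operator \<open>lim\<close> carries information only once
  convergence is known.\<close>

lemma generic_waldschmidt_LIMSEQ:
  assumes "N \<ge> 1"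
  shows "(\<lambda>m. real (alpha (generic_symbolic_power N s m :: 'k::field ratfun mpol set)) / real m)
    \<longlonglongrightarrow> generic_waldschmidt TYPE('k) N s"
proof -
  interpret projective "generic_field N s :: 'k ratfun set" N
    by (rule projective_generic_field)
  let ?I = "generic_symbolic_power N s :: nat \<Rightarrow> 'k ratfun mpol set"
  have "alpha (?I (m + n)) \<le> alpha (?I m) + alpha (?I n)" for m n
  proof -
    obtain f where f: "f \<in> ?I m" "f \<noteq> 0" "total_degree f = alpha (?I m)"
      using generic_symbolic_power_nonzero[OF assms, of s m] alpha_attained by metis
    obtain g where g: "g \<in> ?I n" "g \<noteq> 0" "total_degree g = alpha (?I n)"
      using generic_symbolic_power_nonzero[OF assms, of s n] alpha_attained by metis
    have "f * g \<in> ?I (m + n)"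
      using f(1) g(1) unfolding symbolic_power_def by (intro INT_I pow_ideal_mult) (simp_all only: INT_iff)
    then have "alpha (?I (m + n)) \<le> total_degree (f * g)" using f(2) g(2) by (intro alpha_le) simp_all
    also have "\<dots> \<le> alpha (?I m) + alpha (?I n)"
      using total_degree_mult_le[OF f(2) g(2)] f(3) g(3) by simp
    finally show ?thesis .
  qed
  then have "convergent (\<lambda>m. real (alpha (?I m)) / real m)"
    by (intro subadditive_convergent) (simp_all flip: of_nat_add)
  then show ?thesis unfolding generic_waldschmidt_def waldschmidt_def by (rule convergent_LIMSEQ_iff[THEN iffD1])
qed

lemma generic_waldschmidt_mult:
  assumes "N \<ge> 1" "b > 0" "s > 0"
  shows "generic_waldschmidt TYPE('k::alg_closed_field) N (b * s ^ N) \<ge> real s * generic_waldschmidt TYPE('k) N b"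
proof -
  let ?I = "generic_symbolic_power N :: nat \<Rightarrow> nat \<Rightarrow> 'k ratfun mpol set"
  have le: "alpha (?I b (s * m)) \<le> alpha (?I (b * s ^ N) m)" for m
  proof -
    obtain f where f: "f \<in> ?I (b * s ^ N) m" "f \<noteq> 0" "total_degree f = alpha (?I (b * s ^ N) m)"
      using generic_symbolic_power_nonzero[OF assms(1), of "b * s ^ N" m] alpha_attained by metis
    obtain g where "g \<in> ?I b (s * m)" "g \<noteq> 0" "total_degree g \<le> total_degree f"
      using symbolic_power_specialize[OF assms(2,3) f(1,2)] .
    then show ?thesis using alpha_le[of g] f(3) by fastforce
  qed
  have "strict_mono (\<lambda>m. s * m)" using assms(3) by (simp add: strict_mono_def)
  \<comment> \<open>The comparison concerns exponents \<open>s * m\<close> for the \<open>b\<close>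
    points, so their limit is taken along multiples of \<open>s\<close>; dividing by
    \<open>m\<close> instead of \<open>s * m\<close> produces the factor \<open>s\<close>.\<close>
  from LIMSEQ_subseq_LIMSEQ[OF generic_waldschmidt_LIMSEQ[OF assms(1), where 'k = 'k and s = b] this]
  have "(\<lambda>m. real s * (real (alpha (?I b (s * m))) / real (s * m)))
      \<longlonglongrightarrow> real s * generic_waldschmidt TYPE('k) N b"
    by (intro tendsto_mult_left) (simp add: o_def)
  moreover have "real s * (real (alpha (?I b (s * m))) / real (s * m)) =
      real (alpha (?I b (s * m))) / real m" for m
    using assms(3) by simp
  ultimately have "(\<lambda>m. real (alpha (?I b (s * m))) / real m)
      \<longlonglongrightarrow> real s * generic_waldschmidt TYPE('k) N b" by simp
  then show ?thesis
    by (rule LIMSEQ_le[OF _ generic_waldschmidt_LIMSEQ[OF assms(1)]])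
      (use le in \<open>auto intro!: exI divide_right_mono\<close>)
qed

theorem theorem3p2:
  fixes N b k :: nat
  assumes "N \<ge> 4" and "b > 0" and "k > 0"
  shows "generic_waldschmidt TYPE('k::alg_closed_field) N (b * (2 ^ N) ^ k)
           \<ge> 2 ^ k * generic_waldschmidt TYPE('k) N b"
proof -
  \<comment> \<open>A grid of side 2^k splits each of the \<open>b\<close> points at once, with no
    induction on \<open>k\<close>.\<close>
  have "(2 ^ k) ^ N = ((2 ^ N) ^ k :: nat)" by (simp add: mult.commute flip: power_mult)
  then show ?thesis
    using generic_waldschmidt_mult[where 'k = 'k, of N b "2 ^ k"] assms by simp
qed

end
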